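(* Let $\dot x=F(x)=Ax+X(x)$ be an analytic system near $0\in\mathbb C^n$, where $X$ has only terms of degree at least two and $A$ is in lower-triangular Jordan form with diagonal $\lambda=(\lambda_1,\dots,\lambda_n)^\top$. Let $0\le l\le n$ be such that $\lambda_1,\dots,\lambda_l\in i\mathbb R$ and $\lambda_{l+1},\dots,\lambda_n$ have positive real parts, and assume that $\lambda_1,\dots,\lambda_l$ are pairwise commensurable. Assume moreover that for some (formal) Poincaré-Dulac normal form $\dot x=G(x)$ of the system, the vector $G'$ formed by the first $l$ components of $G$ satisfies $$G'(x')=(\lambda'\odot x')\,a(x')$$ with a formal power series $a(x')=1+\cdots$. Then the system admits a convergent transformation to normal form.
   Context: $\odot$ is the componentwise product. For $v=(v_1,\dots,v_n)$ write $v'=(v_1,\dots,v_l)$ and $v''=(v_{l+1},\dots,v_n)$. The matrix $A$ has diagonal entries $\lambda_1,\dots,\lambda_n$, subdiagonal entries $\sigma_2,\dots,\sigma_n\in\mathbb C$ with $\sigma_i=0$ whenever $\lambda_i\ne\lambda_{i-1}$, and all other entries zero. The coordinates are ordered so that $0=\mathrm{Re}\,\lambda_1=\dots=\mathrm{Re}\,\lambda_l<\mathrm{Re}\,\lambda_{l+1}\le\dots\le\mathrm{Re}\,\lambda_n$. Two numbers are commensurable if they are linearly dependent over $\mathbb Q$. Let $\mathbf N_i=\{Q\in\mathbb Z^n: q_i\ge -1,\ q_j\ge 0 \text{ for } j\ne i\}$, $\mathbf N=\bigcup_i\mathbf N_i$, $\langle Q,\lambda\rangle=\sum q_i\lambda_i$.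 Every formal power series vector field is written uniquely as $F(x)=\sum_{Q\in\mathbf N}(x\odot F_Q)x^Q$, $F_Q\in\mathbb C^n$ (the $i$-th entry of $F_Q$ being $0$ unless $Q\in\mathbf N_i$). It is in Poincaré-Dulac normal form if $F_Q=0$ whenever $\langle Q,\lambda\rangle\neq0$. A transformation is a formal substitution $x=H(y)=y+h(y)$ with $h$ having only terms of degree at least two; the transformed field $\widetilde F$ is defined by $DH(y)\widetilde F(y)=F(H(y))$; if $\widetilde F$ is in normal form it is called a normal form of $F$. The transformation is convergent if $H$ converges near $0$. In the situation considered, the first $l$ components of any normal form depend on $x'$ only, so $G'(x')$ is meaningful. *)

theory Defs
  imports "HOL-Analysis.Analysis" "HOL-Library.Poly_Mapping"
begin

section \<open>Formal power series in several variables\<close>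

text \<open>
  Variables are indexed by natural numbers and exponents are finitely supported, so that all
  formal power series live in one commutative ring. Series in the variables $x_i$, $i \in V$, are
  singled out by the predicate \<open>in_vars V\<close>; $n$-dimensional objects use $V = \{1,\dots,n\}$.
\<close>

typedef 'a mfps = "UNIV :: ((nat \<Rightarrow>\<^sub>0 nat) \<Rightarrow> 'a) set"
  morphisms mcoeff Abs_mfps ..

lemma mcoeff_Abs [simp]: "mcoeff (Abs_mfps f) = f"
  by (simp add: Abs_mfps_inverse)

lemma mfps_eqI: "(\<And>K. mcoeff f K = mcoeff g K) \<Longrightarrow> f = g"
  by (simp add: mcoeff_inject[symmetric] fun_eq_iff)

definition tdeg :: "(nat \<Rightarrow>\<^sub>0 nat) \<Rightarrow> nat" where
  "tdeg K = (\<Sum>i\<in>Poly_Mapping.keys K. Poly_Mapping.lookup K i)"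

definition splits :: "(nat \<Rightarrow>\<^sub>0 nat) \<Rightarrow> ((nat \<Rightarrow>\<^sub>0 nat) \<times> (nat \<Rightarrow>\<^sub>0 nat)) set" where
  "splits K = {(P, Q). P + Q = K}"

lemma finite_splits [simp]: "finite (splits K)"
proof -
  define B where "B = {f :: nat \<Rightarrow> nat.
    \<forall>i. (i \<in> Poly_Mapping.keys K \<longrightarrow> f i \<in> {..tdeg K}) \<and> (i \<notin> Poly_Mapping.keys K \<longrightarrow> f i = 0)}"
  have fin: "finite B"
    unfolding B_def by (rule finite_set_of_finite_funs) auto
  have sub: "Poly_Mapping.lookup P \<in> B" if "P + Q = K" for P Q
  proof -
    have le: "Poly_Mapping.lookup P i \<le> Poly_Mapping.lookup K i" for i
      unfolding that[symmetric] by (simp add: lookup_add)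
    have "Poly_Mapping.lookup K i \<le> tdeg K" if "i \<in> Poly_Mapping.keys K" for i
      unfolding tdeg_def using that by (intro member_le_sum) auto
    then show ?thesis
      using le unfolding B_def by (auto simp: in_keys_iff intro: order_trans) (metis le_zero_eq)
  qed
  define C where "C = {P. Poly_Mapping.lookup P \<in> B}"
  have "inj_on Poly_Mapping.lookup C"
    by (auto intro: inj_onI poly_mapping_eqI)
  moreover have "Poly_Mapping.lookup ` C \<subseteq> B"
    by (simp add: C_def image_subset_iff)
  ultimately have "finite C"
    using fin inj_on_finite by blast
  then have fin_CC: "finite (C \<times> C)"
    by (rule finite_cartesian_product) fact
  have "splits K \<subseteq> C \<times> C"
  proof (rule subsetI)
    fix PQ assume "PQ \<in> splits K"
    then have "fst PQ + snd PQ = K" "snd PQ + fst PQ = K"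
      by (simp_all add: splits_def case_prod_unfold add.commute)
    then show "PQ \<in> C \<times> C"
      using sub by (simp add: C_def mem_Times_iff)
  qed
  then show ?thesis
    using fin_CC by (rule finite_subset)
qed

instantiation mfps :: (comm_ring_1) comm_ring_1
begin

definition "0 = Abs_mfps (\<lambda>K. 0)"
definition "1 = Abs_mfps (\<lambda>K. if K = 0 then 1 else 0)"
definition "f + g = Abs_mfps (\<lambda>K. mcoeff f K + mcoeff g K)"
definition "- f = Abs_mfps (\<lambda>K. - mcoeff f K)"
definition "f - g = Abs_mfps (\<lambda>K. mcoeff f K - mcoeff g K)"
definition "f * g = Abs_mfps (\<lambda>K. \<Sum>(P, Q)\<in>splits K. mcoeff f P * mcoeff g Q)"

lemma mfps_mult_assoc: "(f * g) * h = f * (g * (h :: 'a mfps))"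
proof (rule mfps_eqI)
  fix K
  have "mcoeff ((f * g) * h) K =
      (\<Sum>(S, R)\<in>splits K. \<Sum>(P, Q)\<in>splits S. mcoeff f P * mcoeff g Q * mcoeff h R)"
    by (simp add: times_mfps_def sum_distrib_right case_prod_unfold)
  also have "\<dots> = (\<Sum>((S, R), (P, Q))\<in>(SIGMA SR:splits K. splits (fst SR)).
      mcoeff f P * mcoeff g Q * mcoeff h R)"
    by (simp add: sum.Sigma case_prod_unfold)
  also have "\<dots> = (\<Sum>((P, T), (Q, R))\<in>(SIGMA PT:splits K. splits (snd PT)).
      mcoeff f P * (mcoeff g Q * mcoeff h R))"
    by (rule sum.reindex_bij_witness[where i = "\<lambda>((P, T), (Q, R)). ((P + Q, R), (P, Q))"
          and j = "\<lambda>((S, R), (P, Q)). ((P, Q + R), (Q, R))"])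
       (auto simp: splits_def add.assoc mult.assoc)
  also have "\<dots> = (\<Sum>(P, T)\<in>splits K. \<Sum>(Q, R)\<in>splits T. mcoeff f P * (mcoeff g Q * mcoeff h R))"
    by (simp add: sum.Sigma case_prod_unfold)
  also have "\<dots> = mcoeff (f * (g * h)) K"
    by (simp add: times_mfps_def sum_distrib_left case_prod_unfold)
  finally show "mcoeff ((f * g) * h) K = mcoeff (f * (g * h)) K" .
qed

lemma mfps_mult_commute: "f * g = g * (f :: 'a mfps)"
proof (rule mfps_eqI)
  fix K
  have "(\<Sum>(P, Q)\<in>splits K. mcoeff f P * mcoeff g Q) =
        (\<Sum>(P, Q)\<in>splits K. mcoeff g P * mcoeff f Q)"
    by (rule sum.reindex_bij_witness[where i = prod.swap and j = prod.swap])
       (clarsimp simp: splits_def add.commute mult.commute)+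
  then show "mcoeff (f * g) K = mcoeff (g * f) K"
    by (simp add: times_mfps_def)
qed

lemma mfps_mult_1: "1 * f = (f :: 'a mfps)"
proof (rule mfps_eqI)
  fix K
  have "mcoeff (1 * f) K =
      (\<Sum>(P, Q)\<in>splits K. (if P = 0 then 1 else 0) * mcoeff f Q)"
    by (simp add: times_mfps_def one_mfps_def)
  also have "\<dots> = (\<Sum>(P, Q)\<in>{(0 :: nat \<Rightarrow>\<^sub>0 nat, K)}. (if P = 0 then 1 else 0) * mcoeff f Q)"
  proof (rule sum.mono_neutral_right)
    show "finite (splits K)" by simp
    show "{(0, K)} \<subseteq> splits K" by (simp add: splits_def)
    show "\<forall>PQ\<in>splits K - {(0, K)}. (case PQ of (P, Q) \<Rightarrow>
        (if P = 0 then 1 else 0) * mcoeff f Q) = 0"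
    proof
      fix PQ assume PQ: "PQ \<in> splits K - {(0, K)}"
      then have "fst PQ + snd PQ = K" "PQ \<noteq> (0, K)"
        by (simp_all add: splits_def case_prod_unfold)
      then have "fst PQ \<noteq> 0"
        by (metis add_0 prod.collapse)
      then show "(case PQ of (P, Q) \<Rightarrow> (if P = 0 then 1 else 0) * mcoeff f Q) = 0"
        by (simp add: case_prod_unfold)
    qed
  qed
  finally have "mcoeff (1 * f) K = (\<Sum>(P, Q)\<in>{(0 :: nat \<Rightarrow>\<^sub>0 nat, K)}.
      (if P = 0 then 1 else 0) * mcoeff f Q)" .
  then show "mcoeff (1 * f) K = mcoeff f K"
    by simp
qed

instance
proof
  fix f g h :: "'a mfps"
  show "f * g * h = f * (g * h)" by (rule mfps_mult_assoc)
  show "f * g = g * f" by (rule mfps_mult_commute)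
  show "1 * f = f" by (rule mfps_mult_1)
  show "(f + g) * h = f * h + g * h"
    by (simp add: times_mfps_def plus_mfps_def distrib_right sum.distrib case_prod_unfold)
  have "mcoeff 0 0 \<noteq> mcoeff (1 :: 'a mfps) 0"
    by (simp add: zero_mfps_def one_mfps_def)
  then show "(0 :: 'a mfps) \<noteq> 1" by metis
qed (simp_all add: plus_mfps_def zero_mfps_def uminus_mfps_def minus_mfps_def add.assoc
      mcoeff_inverse, simp_all add: add.commute)

end

lemma mcoeff_arith [simp]:
  "mcoeff 0 K = 0"
  "mcoeff 1 K = (if K = 0 then 1 else 0)"
  "mcoeff (f + g) K = mcoeff f K + mcoeff g K"
  "mcoeff (- f) K = - mcoeff f K"
  "mcoeff (f - g) K = mcoeff f K - mcoeff g K"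
  by (simp_all add: zero_mfps_def one_mfps_def plus_mfps_def uminus_mfps_def minus_mfps_def)

lemma mcoeff_mult: "mcoeff (f * g) K = (\<Sum>(P, Q)\<in>splits K. mcoeff f P * mcoeff g Q)"
  by (simp add: times_mfps_def)

definition mconst :: "'a::zero \<Rightarrow> 'a mfps" where
  "mconst c = Abs_mfps (\<lambda>K. if K = 0 then c else 0)"

definition mvar :: "nat \<Rightarrow> 'a::zero_neq_one mfps" where
  "mvar i = Abs_mfps (\<lambda>K. if K = Poly_Mapping.single i 1 then 1 else 0)"

definition in_vars :: "nat set \<Rightarrow> 'a::zero mfps \<Rightarrow> bool" where
  "in_vars V f \<longleftrightarrow> (\<forall>K. mcoeff f K \<noteq> 0 \<longrightarrow> Poly_Mapping.keys K \<subseteq> V)"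

definition order_ge :: "nat \<Rightarrow> 'a::zero mfps \<Rightarrow> bool" where
  "order_ge d f \<longleftrightarrow> (\<forall>K. tdeg K < d \<longrightarrow> mcoeff f K = 0)"

text \<open>Partial derivative with respect to the variable $x_j$.\<close>

definition mderiv :: "nat \<Rightarrow> 'a::comm_ring_1 mfps \<Rightarrow> 'a mfps" where
  "mderiv j f = Abs_mfps (\<lambda>K. of_nat (Poly_Mapping.lookup K j + 1) * mcoeff f (K + Poly_Mapping.single j 1))"

text \<open>
  The substitution $f(H_1,\dots,H_n) = \sum_Q f_Q \, H_1^{q_1}\cdots H_n^{q_n}$ for a series $f$ in
  $x_1,\dots,x_n$. It is only meaningful when all $H_i$ have zero constant term; then
  $H_1^{q_1}\cdots H_n^{q_n}$ has order at least $|Q|$, so only the finitely many $Q$ with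
  $|Q| \le |K|$ contribute to the coefficient at $K$.
\<close>

definition msubst :: "nat \<Rightarrow> 'a::comm_ring_1 mfps \<Rightarrow> (nat \<Rightarrow> 'a mfps) \<Rightarrow> 'a mfps" where
  "msubst n f H = Abs_mfps (\<lambda>K.
     \<Sum>Q | Poly_Mapping.keys Q \<subseteq> {1..n} \<and> tdeg Q \<le> tdeg K.
       mcoeff f Q * mcoeff (\<Prod>i=1..n. H i ^ Poly_Mapping.lookup Q i) K)"

text \<open>Convergence in some polydisc around the origin (in $\mathbb C$, summability is absolute).\<close>

definition convergent_mfps :: "nat \<Rightarrow> complex mfps \<Rightarrow> bool" where
  "convergent_mfps n f \<longleftrightarrow> (\<exists>r>0. \<forall>x :: nat \<Rightarrow> complex. (\<forall>i\<in>{1..n}. cmod (x i) < r) \<longrightarrow>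
     (\<lambda>Q. mcoeff f Q * (\<Prod>i=1..n. x i ^ Poly_Mapping.lookup Q i)) summable_on
       {Q. Poly_Mapping.keys Q \<subseteq> {1..n}})"


section \<open>Vector fields, transformations and normal forms\<close>

text \<open>Only the components $1,\dots,n$ of a vector field or a substitution are relevant.\<close>

type_synonym field = "nat \<Rightarrow> complex mfps"

definition formal_field :: "nat \<Rightarrow> field \<Rightarrow> bool" where
  "formal_field n F \<longleftrightarrow> (\<forall>i\<in>{1..n}. in_vars {1..n} (F i))"

text \<open>A convergent field is the Taylor expansion of an analytic germ at the origin.\<close>

definition convergent_field :: "nat \<Rightarrow> field \<Rightarrow> bool" where
  "convergent_field n F \<longleftrightarrow> formal_field n F \<and> (\<forall>i\<in>{1..n}. convergent_mfps n (F i))"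

definition jordan_matrix :: "(nat \<Rightarrow> complex) \<Rightarrow> (nat \<Rightarrow> complex) \<Rightarrow> nat \<Rightarrow> nat \<Rightarrow> complex" where
  "jordan_matrix lam sig i j = (if i = j then lam i else if i = j + 1 then sig i else 0)"

definition linear_field :: "nat \<Rightarrow> (nat \<Rightarrow> nat \<Rightarrow> complex) \<Rightarrow> field" where
  "linear_field n A i = (\<Sum>j=1..n. mconst (A i j) * mvar j)"

definition commensurable :: "complex \<Rightarrow> complex \<Rightarrow> bool" where
  "commensurable a b \<longleftrightarrow>
     (\<exists>p q :: rat. (p \<noteq> 0 \<or> q \<noteq> 0) \<and> of_rat p * a + of_rat q * b = 0)"

definition NN_comp :: "nat \<Rightarrow> nat \<Rightarrow> (nat \<Rightarrow>\<^sub>0 int) set" where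
  "NN_comp n i = {Q. Poly_Mapping.keys Q \<subseteq> {1..n} \<and> Poly_Mapping.lookup Q i \<ge> -1 \<and>
     (\<forall>j\<in>{1..n}. j \<noteq> i \<longrightarrow> Poly_Mapping.lookup Q j \<ge> 0)}"

definition NN :: "nat \<Rightarrow> (nat \<Rightarrow>\<^sub>0 int) set" where
  "NN n = (\<Union>i\<in>{1..n}. NN_comp n i)"

definition pairing :: "nat \<Rightarrow> (nat \<Rightarrow>\<^sub>0 int) \<Rightarrow> (nat \<Rightarrow> complex) \<Rightarrow> complex" where
  "pairing n Q lam = (\<Sum>i=1..n. of_int (Poly_Mapping.lookup Q i) * lam i)"

text \<open>
  The coefficients $F_Q$ in $F = \sum_{Q} (x \odot F_Q) x^Q$: the $i$-th entry of $F_Q$ is the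
  coefficient of $x_i x^Q = x^{Q + e_i}$ in the $i$-th component of $F$.
\<close>

definition field_coeff :: "nat \<Rightarrow> field \<Rightarrow> (nat \<Rightarrow>\<^sub>0 int) \<Rightarrow> nat \<Rightarrow> complex" where
  "field_coeff n F Q i = (if Q \<in> NN_comp n i
     then mcoeff (F i) (Poly_Mapping.map nat (Q + Poly_Mapping.single i 1)) else 0)"

definition in_normal_form :: "nat \<Rightarrow> (nat \<Rightarrow> complex) \<Rightarrow> field \<Rightarrow> bool" where
  "in_normal_form n lam F \<longleftrightarrow> formal_field n F \<and>
     (\<forall>Q\<in>NN n. pairing n Q lam \<noteq> 0 \<longrightarrow> (\<forall>i\<in>{1..n}. field_coeff n F Q i = 0))"

definition transformation :: "nat \<Rightarrow> (nat \<Rightarrow> complex mfps) \<Rightarrow> bool" where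
  "transformation n H \<longleftrightarrow>
     (\<forall>i\<in>{1..n}. in_vars {1..n} (H i) \<and> order_ge 2 (H i - mvar i))"

definition convergent_transformation :: "nat \<Rightarrow> (nat \<Rightarrow> complex mfps) \<Rightarrow> bool" where
  "convergent_transformation n H \<longleftrightarrow>
     transformation n H \<and> (\<forall>i\<in>{1..n}. convergent_mfps n (H i))"

text \<open>The field $\widetilde F$ with $DH \cdot \widetilde F = F \circ H$.\<close>

definition transforms_to :: "nat \<Rightarrow> (nat \<Rightarrow> complex mfps) \<Rightarrow> field \<Rightarrow> field \<Rightarrow> bool" where
  "transforms_to n H F Ft \<longleftrightarrow> formal_field n Ft \<and>
     (\<forall>i\<in>{1..n}. (\<Sum>j=1..n. mderiv j (H i) * Ft j) = msubst n (F i) H)"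

definition normal_form_of :: "nat \<Rightarrow> (nat \<Rightarrow> complex) \<Rightarrow> field \<Rightarrow> field \<Rightarrow> bool" where
  "normal_form_of n lam F G \<longleftrightarrow> in_normal_form n lam G \<and>
     (\<exists>H. transformation n H \<and> transforms_to n H F G)"

end

theory Submission
  imports Defs
begin

text \<open>
  Write $H = y + h$ for a transformation and $G$ for the transformed field. Composing a transformation
  to normal form with one that is itself resonant (it commutes with the semisimple linear part)
  leads to normal form again. The freedom is used to reach the distinguished normal form, in which
  no component $h_i$ contains a resonant monomial. The condition $G' = (\<lambda>' \odot y')\,a$ survives:
  by Euler's identity, a resonant substitution maps $\<lambda>' \odot y'$ to itself and only replaces $a$ by a
  substitution instance $1 + b$ (\<open>distinguished_normal_form\<close>).

  The equation $DH \cdot G = F \circ H$ splits into its resonant part, which expresses $G$ by $X \circ H$,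
  and its nonresonant part
  \[ p_i := (D_\<lambda> - \<lambda>_i) h_i = \<sigma>_i h_{i-1} + [X_i \circ H]_{nonres} - b\, E_i
       - \sum_{j > l} \partial_j h_i \, g_j, \qquad E_i = \sum_{j \le l} \<lambda>_j y_j \partial_j h_i, \]
  where $D_\<lambda> = \sum_j \<lambda>_j y_j \partial_j$ multiplies $y^P$ by $\langle P, \<lambda> \rangle$ and $g_j$ is the $j$-th
  component of $G$ without its diagonal linear term. Two facts make the resulting recursion for $p$
  harmless.

  First, there are no small divisors: the numbers $\langle P', \<lambda>' \rangle$ lie in a lattice
  $\mathbb Z \kappa$ because $\<lambda>_1, \dots, \<lambda>_l$ are pairwise commensurable, and the real part of
  $\langle P, \<lambda> \rangle$ grows linearly in $|P''|$. Hence a nonzero divisor dominates a multiple of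
  $1 + |P''| + |\langle P', \<lambda>' \rangle|$ (\<open>small_divisor_bound\<close>).

  Second, this is exactly the growth of the derivatives that occur: $E_i$ multiplies $y^P$ by
  $\langle P', \<lambda>' \rangle$ and $y_j \partial_j$ with $j > l$ multiplies it by at most $|P''|$. The hypothesis on
  $G'$ serves to bring all derivatives with respect to $y'$ into the form $b\, E_i$; without it these
  derivatives would not be controlled by the divisors.

  So $h_i$, $E_i$ and $y_j \partial_j h_i$ are all bounded by $p_i$ in any weighted $\ell^1$ norm of
  coefficients. With weights $\rho_i = B^i s$, a large $B$ makes the nilpotent terms small and a small
  $s$ makes the nonlinear terms small. For the norm of the truncation at degree $D$ the equation
  then gives $V_{D+1} \le V_{D+1}/2 + 1/2$ as soon as $V_D \le 1$ (\<open>majorant_step\<close>), because the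
  coefficients of $X \circ H$ up to degree $D + 1$ only involve those of $H$ up to degree $D$. The bound
  $V_D \le 1$ for all $D$ is the convergence of $H$.
\<close>

(* Unit exponents are written with the numeral 1; rewriting it to Suc 0 would block the rules below. *)
declare One_nat_def [simp del]

section \<open>Exponents and monomials\<close>

lemma keys_add_nat: "Poly_Mapping.keys (P + Q) = Poly_Mapping.keys P \<union> Poly_Mapping.keys Q"
  for P Q :: "nat \<Rightarrow>\<^sub>0 nat"
  by (auto simp: in_keys_iff lookup_add)

lemma tdeg_eq_sum:
  assumes "finite A" "Poly_Mapping.keys K \<subseteq> A"
  shows "tdeg K = (\<Sum>i\<in>A. Poly_Mapping.lookup K i)"
  unfolding tdeg_def using assms by (intro sum.mono_neutral_left) (auto simp: in_keys_iff)

lemma tdeg_add [simp]: "tdeg (P + Q) = tdeg P + tdeg Q"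
proof -
  let ?A = "Poly_Mapping.keys P \<union> Poly_Mapping.keys Q"
  show ?thesis
    using tdeg_eq_sum[of ?A P] tdeg_eq_sum[of ?A Q] tdeg_eq_sum[of ?A "P + Q"]
    by (simp add: keys_add_nat lookup_add sum.distrib)
qed

lemma tdeg_0 [simp]: "tdeg 0 = 0"
  by (simp add: tdeg_def)

lemma tdeg_single [simp]: "tdeg (Poly_Mapping.single i k) = k"
  by (cases "k = 0") (simp_all add: tdeg_def)

lemma tdeg_eq_0_iff [simp]: "tdeg K = 0 \<longleftrightarrow> K = 0"
  by (auto simp: tdeg_def poly_mapping_eq_iff in_keys_iff fun_eq_iff)

lemma lookup_le_tdeg: "Poly_Mapping.lookup K i \<le> tdeg K"
  by (cases "i \<in> Poly_Mapping.keys K") (auto simp: tdeg_def in_keys_iff intro: member_le_sum)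

definition exps :: "nat \<Rightarrow> nat \<Rightarrow> (nat \<Rightarrow>\<^sub>0 nat) set" where
  "exps n D = {K. Poly_Mapping.keys K \<subseteq> {1..n} \<and> tdeg K \<le> D}"

lemma finite_exps [simp]: "finite (exps n D)"
proof -
  define B where "B = {f :: nat \<Rightarrow> nat. \<forall>i. (i \<in> {1..n} \<longrightarrow> f i \<in> {..D}) \<and> (i \<notin> {1..n} \<longrightarrow> f i = 0)}"
  have "finite B"
    unfolding B_def by (rule finite_set_of_finite_funs) auto
  moreover have "Poly_Mapping.lookup ` exps n D \<subseteq> B"
  proof clarify
    fix K assume K: "K \<in> exps n D"
    have "Poly_Mapping.lookup K i \<le> D" for i
      using K lookup_le_tdeg[of K i] by (simp add: exps_def)
    then show "Poly_Mapping.lookup K \<in> B"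
      using K by (auto simp: B_def exps_def in_keys_iff)
  qed
  moreover have "inj_on Poly_Mapping.lookup (exps n D)"
    by (auto intro: inj_onI poly_mapping_eqI)
  ultimately show ?thesis
    using inj_on_finite by blast
qed

lemma exps_mono: "D \<le> D' \<Longrightarrow> exps n D \<subseteq> exps n D'"
  by (auto simp: exps_def)

lemma exponent_decrease:
  fixes K :: "nat \<Rightarrow>\<^sub>0 nat"
  assumes "Poly_Mapping.lookup K i \<noteq> 0"
  obtains L where "K = L + Poly_Mapping.single i 1"
proof
  show "K = (K - Poly_Mapping.single i 1) + Poly_Mapping.single i 1"
    using assms by (intro poly_mapping_eqI) (auto simp: lookup_add lookup_minus lookup_single when_def)
qed

lemma exponent_induct [consumes 1, case_names zero add]:
  assumes "Poly_Mapping.keys K \<subseteq> V"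
    and "P (0 :: nat \<Rightarrow>\<^sub>0 nat)"
    and "\<And>L i. i \<in> V \<Longrightarrow> Poly_Mapping.keys L \<subseteq> V \<Longrightarrow> P L \<Longrightarrow> P (L + Poly_Mapping.single i 1)"
  shows "P K"
  using assms(1)
proof (induction "tdeg K" arbitrary: K)
  case 0
  then show ?case using assms(2) by simp
next
  case (Suc d)
  then have "K \<noteq> 0" by auto
  then obtain i where i: "i \<in> Poly_Mapping.keys K"
    by (metis keys_eq_empty equals0I)
  then obtain L where L: "K = L + Poly_Mapping.single i 1"
    using exponent_decrease[of K i] by (metis in_keys_iff)
  have "Poly_Mapping.keys L \<subseteq> V" "i \<in> V"
    using Suc.prems i by (auto simp: L keys_add_nat)
  moreover have "d = tdeg L" using Suc.hyps(2) L by simp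
  ultimately show ?case
    unfolding L using Suc.hyps(1) assms(3) by blast
qed

definition mmono :: "(nat \<Rightarrow>\<^sub>0 nat) \<Rightarrow> 'a::zero_neq_one mfps" where
  "mmono K = Abs_mfps (\<lambda>L. if L = K then 1 else 0)"

lemma mcoeff_mmono [simp]: "mcoeff (mmono K) L = (if L = K then 1 else 0)"
  by (simp add: mmono_def)

lemma mmono_0: "mmono 0 = (1 :: 'a::comm_ring_1 mfps)"
  by (rule mfps_eqI) simp

lemma mvar_eq_mmono: "mvar i = mmono (Poly_Mapping.single i 1)"
  by (simp add: mvar_def mmono_def)

lemma mcoeff_mmono_mult_add [simp]:
  "mcoeff (mmono P * f) (P + R) = mcoeff (f :: 'a::comm_ring_1 mfps) R"
proof -
  have "mcoeff (mmono P * f) (P + R) = (\<Sum>(A, B)\<in>{(P, R)}. mcoeff (mmono P) A * mcoeff f B)"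
    unfolding mcoeff_mult by (rule sum.mono_neutral_right) (simp, auto simp: splits_def split: if_splits)
  then show ?thesis by simp
qed

lemma mcoeff_mmono_mult_eq_0:
  assumes "\<And>R. K \<noteq> P + R"
  shows "mcoeff (mmono P * f) K = (0 :: 'a::comm_ring_1)"
  unfolding mcoeff_mult using assms by (intro sum.neutral) (force simp: splits_def)

lemma mcoeff_mvar_mult [simp]:
  "mcoeff (mvar i * f) (R + Poly_Mapping.single i 1) = mcoeff (f :: 'a::comm_ring_1 mfps) R"
  using mcoeff_mmono_mult_add[of "Poly_Mapping.single i 1" f R]
  by (simp add: mvar_eq_mmono add.commute)

lemma mcoeff_mvar_mult_eq_0:
  assumes "Poly_Mapping.lookup K i = 0"
  shows "mcoeff (mvar i * f) K = (0 :: 'a::comm_ring_1)"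
  unfolding mvar_eq_mmono using assms
  by (intro mcoeff_mmono_mult_eq_0) (auto simp: lookup_add)

lemma mmono_add: "mmono (P + Q) = mmono P * (mmono Q :: 'a::comm_ring_1 mfps)"
proof (rule mfps_eqI)
  fix K
  show "mcoeff (mmono (P + Q)) K = mcoeff (mmono P * mmono Q :: 'a mfps) K"
    by (cases "\<exists>R. K = P + R") (auto simp: mcoeff_mmono_mult_eq_0)
qed

lemma mcoeff_mconst_mult [simp]:
  "mcoeff (mconst c * f) K = c * mcoeff (f :: 'a::comm_ring_1 mfps) K"
proof -
  have "mcoeff (mconst c * f) K = (\<Sum>(A, B)\<in>{(0, K)}. mcoeff (mconst c) A * mcoeff f B)"
    unfolding mcoeff_mult by (rule sum.mono_neutral_right) (simp, auto simp: splits_def mconst_def split: if_splits)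
  then show ?thesis by (simp add: mconst_def)
qed

lemma mcoeff_mconst: "mcoeff (mconst c) K = (if K = 0 then c else 0)"
  by (simp add: mconst_def)

lemma mcoeff_mvar: "mcoeff (mvar i) K = (if K = Poly_Mapping.single i 1 then 1 else 0)"
  by (simp add: mvar_def)

lemma mcoeff_sum [simp]: "mcoeff (\<Sum>a\<in>A. f a) K = (\<Sum>a\<in>A. mcoeff (f a :: 'a::comm_ring_1 mfps) K)"
  by (induction A rule: infinite_finite_induct) simp_all


section \<open>Order, support and derivatives of power series\<close>

lemma order_ge_0 [simp]: "order_ge 0 f"
  by (simp add: order_ge_def)

lemma order_ge_zero [simp]: "order_ge d (0 :: 'a::comm_ring_1 mfps)"
  by (simp add: order_ge_def)

lemma order_ge_mono: "order_ge d f \<Longrightarrow> d' \<le> d \<Longrightarrow> order_ge d' f"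
  by (simp add: order_ge_def)

lemma order_ge_add: "order_ge d f \<Longrightarrow> order_ge d g \<Longrightarrow> order_ge d (f + g :: 'a::comm_ring_1 mfps)"
  by (simp add: order_ge_def)

lemma order_ge_uminus: "order_ge d f \<Longrightarrow> order_ge d (- f :: 'a::comm_ring_1 mfps)"
  by (simp add: order_ge_def)

lemma order_ge_diff: "order_ge d f \<Longrightarrow> order_ge d g \<Longrightarrow> order_ge d (f - g :: 'a::comm_ring_1 mfps)"
  by (simp add: order_ge_def)

lemma order_ge_sum: "(\<And>a. a \<in> A \<Longrightarrow> order_ge d (f a)) \<Longrightarrow> order_ge d (\<Sum>a\<in>A. f a :: 'a::comm_ring_1 mfps)"
  by (simp add: order_ge_def)

lemma order_ge_mult:
  assumes "order_ge d f" "order_ge e g"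
  shows "order_ge (d + e) (f * g :: 'a::comm_ring_1 mfps)"
  unfolding order_ge_def mcoeff_mult
proof (intro allI impI sum.neutral ballI, clarify)
  fix K A B assume "tdeg K < d + e" "(A, B) \<in> splits K"
  then have "tdeg A < d \<or> tdeg B < e" by (auto simp: splits_def)
  then show "mcoeff f A * mcoeff g B = 0" using assms by (auto simp: order_ge_def)
qed

lemma order_ge_mult_left: "order_ge d f \<Longrightarrow> order_ge d (g * f :: 'a::comm_ring_1 mfps)"
  using order_ge_mult[of 0 g d f] by simp

lemma order_ge_power: "order_ge 1 f \<Longrightarrow> order_ge k (f ^ k :: 'a::comm_ring_1 mfps)"
proof (induction k)
  case (Suc k)
  then show ?case using order_ge_mult[of 1 f k "f ^ k"] by (simp add: plus_1_eq_Suc)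
qed simp

lemma order_ge_prod:
  assumes "\<And>i. i \<in> A \<Longrightarrow> order_ge (e i) (f i :: 'a::comm_ring_1 mfps)"
  shows "order_ge (\<Sum>i\<in>A. e i) (\<Prod>i\<in>A. f i)"
  using assms by (induction A rule: infinite_finite_induct) (auto intro: order_ge_mult)

lemma order_ge_mvar [simp]: "order_ge 1 (mvar i :: 'a::comm_ring_1 mfps)"
  unfolding order_ge_def mcoeff_mvar by (metis less_irrefl tdeg_single)

lemma order_ge_mderiv: "order_ge (Suc d) f \<Longrightarrow> order_ge d (mderiv j f)"
  by (simp add: order_ge_def mderiv_def)

lemma mfps_eqI_order:
  assumes "\<And>d. order_ge d (f - g)"
  shows "f = (g :: 'a::comm_ring_1 mfps)"
proof (rule mfps_eqI)
  fix K show "mcoeff f K = mcoeff g K"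
    using assms[of "Suc (tdeg K)"] by (simp add: order_ge_def)
qed

lemma in_vars_mono: "in_vars V f \<Longrightarrow> V \<subseteq> W \<Longrightarrow> in_vars W f"
  by (auto simp: in_vars_def)

lemma in_vars_0 [simp]: "in_vars V (0 :: 'a::comm_ring_1 mfps)"
  by (simp add: in_vars_def)

lemma in_vars_1 [simp]: "in_vars V (1 :: 'a::comm_ring_1 mfps)"
  by (simp add: in_vars_def)

lemma in_vars_mmono: "Poly_Mapping.keys K \<subseteq> V \<Longrightarrow> in_vars V (mmono K)"
  by (simp add: in_vars_def)

lemma in_vars_mvar: "i \<in> V \<Longrightarrow> in_vars V (mvar i :: 'a::comm_ring_1 mfps)"
  by (simp add: mvar_eq_mmono in_vars_mmono)

lemma in_vars_mconst [simp]: "in_vars V (mconst c)"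
  by (simp add: in_vars_def mcoeff_mconst)

lemma in_vars_add: "in_vars V f \<Longrightarrow> in_vars V g \<Longrightarrow> in_vars V (f + g :: 'a::comm_ring_1 mfps)"
  unfolding in_vars_def by (metis add.right_neutral mcoeff_arith(3))

lemma in_vars_uminus: "in_vars V f \<Longrightarrow> in_vars V (- f :: 'a::comm_ring_1 mfps)"
  by (simp add: in_vars_def)

lemma in_vars_diff: "in_vars V f \<Longrightarrow> in_vars V g \<Longrightarrow> in_vars V (f - g :: 'a::comm_ring_1 mfps)"
  using in_vars_add[of V f "- g"] by (simp add: in_vars_uminus)

lemma in_vars_sum:
  "(\<And>a. a \<in> A \<Longrightarrow> in_vars V (f a)) \<Longrightarrow> in_vars V (\<Sum>a\<in>A. f a :: 'a::comm_ring_1 mfps)"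
  by (induction A rule: infinite_finite_induct) (auto intro: in_vars_add)

lemma in_vars_mult:
  assumes "in_vars V f" "in_vars V g"
  shows "in_vars V (f * g :: 'a::comm_ring_1 mfps)"
  unfolding in_vars_def
proof (intro allI impI)
  fix K assume "mcoeff (f * g) K \<noteq> 0"
  then obtain P Q where "P + Q = K" "mcoeff f P * mcoeff g Q \<noteq> 0"
    unfolding mcoeff_mult by (elim sum.not_neutral_contains_not_neutral) (auto simp: splits_def)
  then have "mcoeff f P \<noteq> 0" "mcoeff g Q \<noteq> 0" by auto
  with assms \<open>P + Q = K\<close> show "Poly_Mapping.keys K \<subseteq> V"
    unfolding in_vars_def by (metis Un_least keys_add_nat)
qed

lemma in_vars_power: "in_vars V f \<Longrightarrow> in_vars V (f ^ k :: 'a::comm_ring_1 mfps)"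
  by (induction k) (auto intro: in_vars_mult)

lemma in_vars_prod:
  "(\<And>a. a \<in> A \<Longrightarrow> in_vars V (f a)) \<Longrightarrow> in_vars V (\<Prod>a\<in>A. f a :: 'a::comm_ring_1 mfps)"
  by (induction A rule: infinite_finite_induct) (auto intro: in_vars_mult)

lemma mcoeff_mderiv [simp]:
  "mcoeff (mderiv j f) K = of_nat (Poly_Mapping.lookup K j + 1) * mcoeff f (K + Poly_Mapping.single j 1)"
  by (simp add: mderiv_def)

lemma in_vars_mderiv:
  assumes "in_vars V f"
  shows "in_vars V (mderiv j f :: 'a::comm_ring_1 mfps)"
  unfolding in_vars_def
proof (intro allI impI)
  fix K assume "mcoeff (mderiv j f) K \<noteq> 0"
  then have "mcoeff f (K + Poly_Mapping.single j 1) \<noteq> 0" by auto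
  then show "Poly_Mapping.keys K \<subseteq> V"
    using assms by (fastforce simp: in_vars_def keys_add_nat)
qed

lemma mderiv_simps [simp]:
  "mderiv j (0 :: 'a::comm_ring_1 mfps) = 0"
  "mderiv j (f + g :: 'a::comm_ring_1 mfps) = mderiv j f + mderiv j g"
  "mderiv j (f - g :: 'a::comm_ring_1 mfps) = mderiv j f - mderiv j g"
  "mderiv j (mconst c * f :: 'a::comm_ring_1 mfps) = mconst c * mderiv j f"
  by (rule mfps_eqI; simp add: distrib_left right_diff_distrib mult.left_commute)+

lemma mderiv_1 [simp]: "mderiv j (1 :: 'a::comm_ring_1 mfps) = 0"
proof (rule mfps_eqI)
  fix K :: "nat \<Rightarrow>\<^sub>0 nat"
  have "tdeg (K + Poly_Mapping.single j 1) \<noteq> tdeg 0" by simp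
  then have "K + Poly_Mapping.single j 1 \<noteq> 0" by metis
  then show "mcoeff (mderiv j 1) K = mcoeff (0 :: 'a mfps) K" by simp
qed

lemma mderiv_mvar [simp]: "mderiv j (mvar i :: 'a::comm_ring_1 mfps) = (if i = j then 1 else 0)"
proof (rule mfps_eqI)
  fix K :: "nat \<Rightarrow>\<^sub>0 nat"
  have "K + Poly_Mapping.single j 1 = Poly_Mapping.single i 1 \<longleftrightarrow> K = 0 \<and> i = j"
  proof
    assume *: "K + Poly_Mapping.single j 1 = Poly_Mapping.single i (1::nat)"
    then have "tdeg K + 1 = 1" by (metis tdeg_add tdeg_single)
    then have "K = 0" by simp
    with * show "K = 0 \<and> i = j"
      by (metis add_0 lookup_single_eq lookup_single_not_eq zero_neq_one)
  qed auto
  then show "mcoeff (mderiv j (mvar i)) K = mcoeff (if i = j then 1 else 0 :: 'a mfps) K"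
    by (simp add: mcoeff_mvar)
qed

lemma mderiv_mult:
  "mderiv j (f * g) = mderiv j f * g + f * (mderiv j g :: 'a::comm_ring_1 mfps)"
proof -
  let ?e = "Poly_Mapping.single j 1 :: nat \<Rightarrow>\<^sub>0 nat"
  let ?l = "\<lambda>P. of_nat (Poly_Mapping.lookup P j) :: 'a"
  have shift: "mcoeff (mderiv j f * g) K =
      (\<Sum>(P, Q)\<in>splits (K + ?e). ?l P * mcoeff f P * mcoeff g Q)" for f g :: "'a mfps" and K
  proof -
    have "(\<Sum>(P, Q)\<in>splits (K + ?e). ?l P * mcoeff f P * mcoeff g Q) =
        (\<Sum>(P, Q)\<in>(\<lambda>(P, Q). (P + ?e, Q)) ` splits K. ?l P * mcoeff f P * mcoeff g Q)"
    proof (rule sum.mono_neutral_right)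
      show "\<forall>PQ\<in>splits (K + ?e) - (\<lambda>(P, Q). (P + ?e, Q)) ` splits K.
          (case PQ of (P, Q) \<Rightarrow> ?l P * mcoeff f P * mcoeff g Q) = 0"
      proof clarify
        fix P Q assume PQ: "(P, Q) \<in> splits (K + ?e)" "(P, Q) \<notin> (\<lambda>(P, Q). (P + ?e, Q)) ` splits K"
        have "Poly_Mapping.lookup P j = 0"
        proof (rule ccontr)
          assume "Poly_Mapping.lookup P j \<noteq> 0"
          then obtain L where L: "P = L + ?e" by (rule exponent_decrease)
          with PQ(1) have "(L + Q) + ?e = K + ?e" by (simp add: splits_def ac_simps)
          then have "(L, Q) \<in> splits K" by (simp add: splits_def)
          with L PQ(2) show False by force
        qed
        then show "?l P * mcoeff f P * mcoeff g Q = 0" by simp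
      qed
    next
      show "(\<lambda>(P, Q). (P + ?e, Q)) ` splits K \<subseteq> splits (K + ?e)"
      proof clarify
        fix P Q assume "(P, Q) \<in> splits K"
        then have "K = P + Q" by (simp add: splits_def)
        then show "(P + ?e, Q) \<in> splits (K + ?e)"
          by (simp add: splits_def add.assoc add.commute[of ?e])
      qed
    qed simp
    also have "\<dots> = (\<Sum>(P, Q)\<in>splits K. ?l (P + ?e) * mcoeff f (P + ?e) * mcoeff g Q)"
      by (subst sum.reindex) (auto simp: inj_on_def case_prod_unfold)
    also have "\<dots> = mcoeff (mderiv j f * g) K"
      by (simp add: mcoeff_mult lookup_add add.commute)
    finally show ?thesis by simp
  qed
  show ?thesis
  proof (rule mfps_eqI)
    fix K
    have "mcoeff (f * mderiv j g) K = mcoeff (mderiv j g * f) K" by (simp add: mult.commute)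
    also have "\<dots> = (\<Sum>(P, Q)\<in>splits (K + ?e). ?l P * mcoeff g P * mcoeff f Q)" by (rule shift)
    also have "\<dots> = (\<Sum>(P, Q)\<in>splits (K + ?e). ?l Q * mcoeff f P * mcoeff g Q)"
      by (rule sum.reindex_bij_witness[where i = prod.swap and j = prod.swap])
         (clarsimp simp: splits_def add.commute mult.commute mult.left_commute)+
    finally have 1: "mcoeff (f * mderiv j g) K = \<dots>" .
    have "mcoeff (mderiv j (f * g)) K =
        (\<Sum>(P, Q)\<in>splits (K + ?e). of_nat (Poly_Mapping.lookup (K + ?e) j) * (mcoeff f P * mcoeff g Q))"
      by (simp add: mcoeff_mult sum_distrib_left case_prod_unfold lookup_add)
    also have "\<dots> = (\<Sum>(P, Q)\<in>splits (K + ?e). ?l P * mcoeff f P * mcoeff g Q + ?l Q * mcoeff f P * mcoeff g Q)"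
    proof (rule sum.cong[OF refl], clarify)
      fix P Q assume "(P, Q) \<in> splits (K + ?e)"
      then have "K + ?e = P + Q" by (simp add: splits_def)
      then have l: "Poly_Mapping.lookup (K + ?e) j = Poly_Mapping.lookup P j + Poly_Mapping.lookup Q j"
        by (simp only: lookup_add)
      show "of_nat (Poly_Mapping.lookup (K + ?e) j) * (mcoeff f P * mcoeff g Q) =
          ?l P * mcoeff f P * mcoeff g Q + ?l Q * mcoeff f P * mcoeff g Q"
        unfolding l by (simp add: algebra_simps)
    qed
    also have "\<dots> = mcoeff (mderiv j f * g + f * mderiv j g) K"
      by (simp add: shift 1 sum.distrib case_prod_unfold)
    finally show "mcoeff (mderiv j (f * g)) K = mcoeff (mderiv j f * g + f * mderiv j g) K" .
  qed
qed

section \<open>Substitution\<close>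

text \<open>
  Linear maps that lose only a bounded number of orders. They are continuous for the order
  topology, so identities between them need to be checked on monomials only (\<open>cont_linear_eqI\<close>);
  this reduces the algebra of substitution to the algebra of monomials.
\<close>

definition cont_linear :: "('a::comm_ring_1 mfps \<Rightarrow> 'a mfps) \<Rightarrow> bool" where
  "cont_linear T \<longleftrightarrow> (\<forall>f g. T (f + g) = T f + T g) \<and> (\<forall>c f. T (mconst c * f) = mconst c * T f) \<and>
     (\<exists>c. \<forall>d f. order_ge (d + c) f \<longrightarrow> order_ge d (T f))"

lemma cont_linear_ident: "cont_linear (\<lambda>f. f)"
  by (auto simp: cont_linear_def intro!: exI[of _ 0])

lemma cont_linear_mult:
  assumes "cont_linear T"
  shows "cont_linear (\<lambda>f. T f * g)"
proof -
  from assms obtain c where c: "\<And>d f. order_ge (d + c) f \<Longrightarrow> order_ge d (T f)"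
    by (auto simp: cont_linear_def)
  have "order_ge d (T f * g)" if "order_ge (d + c) f" for d f
    using order_ge_mult_left[OF c[OF that], of g] by (simp add: mult.commute)
  then have "\<exists>c. \<forall>d f. order_ge (d + c) f \<longrightarrow> order_ge d (T f * g)" by blast
  then show ?thesis
    using assms by (simp add: cont_linear_def distrib_right mult.assoc)
qed

lemma cont_linear_sum:
  assumes "\<And>a. a \<in> A \<Longrightarrow> cont_linear (T a)" "finite A"
  shows "cont_linear (\<lambda>f. \<Sum>a\<in>A. T a f)"
  using assms(2,1)
proof (induction A)
  case empty
  then show ?case by (auto simp: cont_linear_def)
next
  case (insert a A)
  then have 1: "cont_linear (T a)" and 2: "cont_linear (\<lambda>f. \<Sum>a\<in>A. T a f)" by auto
  then obtain c c' where c: "\<And>d f. order_ge (d + c) f \<Longrightarrow> order_ge d (T a f)"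
      "\<And>d f. order_ge (d + c') f \<Longrightarrow> order_ge d (\<Sum>a\<in>A. T a f)"
    unfolding cont_linear_def by meson
  have "order_ge d (T a f + (\<Sum>a\<in>A. T a f))" if "order_ge (d + max c c') f" for d f
    using that by (intro order_ge_add c) (auto intro: order_ge_mono)
  moreover have "T a (f + g) + (\<Sum>a\<in>A. T a (f + g)) =
      T a f + (\<Sum>a\<in>A. T a f) + (T a g + (\<Sum>a\<in>A. T a g))" for f g
    using 1 2 by (simp add: cont_linear_def algebra_simps)
  moreover have "T a (mconst c * f) + (\<Sum>a\<in>A. T a (mconst c * f)) =
      mconst c * (T a f + (\<Sum>a\<in>A. T a f))" for c f
    using 1 2 by (simp add: cont_linear_def algebra_simps)
  ultimately show ?case
    using insert by (auto simp: cont_linear_def)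
qed

lemma cont_linear_compose:
  assumes "cont_linear S" "cont_linear T"
  shows "cont_linear (\<lambda>f. S (T f))"
proof -
  obtain c c' where c: "\<And>d f. order_ge (d + c) f \<Longrightarrow> order_ge d (S f)"
      "\<And>d f. order_ge (d + c') f \<Longrightarrow> order_ge d (T f)"
    using assms unfolding cont_linear_def by meson
  have "order_ge d (S (T f))" if "order_ge (d + (c + c')) f" for d f
    using that by (intro c) (simp add: add.assoc)
  then show ?thesis
    using assms unfolding cont_linear_def by auto
qed

lemma cont_linear_mderiv: "cont_linear (mderiv j)"
  unfolding cont_linear_def by (auto simp: Suc_eq_plus1[symmetric] intro!: exI[of _ 1] order_ge_mderiv)

lemma cont_linear_sum_apply:
  assumes "cont_linear T" "finite A"
  shows "T (\<Sum>a\<in>A. f a) = (\<Sum>a\<in>A. T (f a))"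
proof -
  have "T (mconst 0 * 0) = mconst 0 * T 0"
    using assms(1) unfolding cont_linear_def by blast
  moreover have "mconst 0 * g = 0" for g :: "'a mfps"
    by (rule mfps_eqI) simp
  ultimately have "T 0 = 0" by simp
  with assms(2) show ?thesis
    by (induction A) (use assms(1) in \<open>auto simp: cont_linear_def\<close>)
qed

lemma order_ge_truncation:
  assumes "in_vars {1..n} f"
  shows "order_ge (Suc D) (f - (\<Sum>K\<in>exps n D. mconst (mcoeff f K) * mmono K) :: 'a::comm_ring_1 mfps)"
  unfolding order_ge_def
proof (intro allI impI)
  fix L assume "tdeg L < Suc D"
  then have "L \<in> exps n D" if "mcoeff f L \<noteq> 0"
    using that assms by (auto simp: exps_def in_vars_def)
  then show "mcoeff (f - (\<Sum>K\<in>exps n D. mconst (mcoeff f K) * mmono K)) L = 0"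
    by (auto simp: if_distrib[of "\<lambda>x. _ * x"] sum.delta cong: if_cong)
qed

text \<open>
  Up to an error of high order $f$ is a linear combination of monomials, and both maps send the
  error to something of high order.
\<close>

lemma cont_linear_eqI:
  assumes f: "in_vars {1..n} f"
    and T: "cont_linear T" and T': "cont_linear T'"
    and mono: "\<And>K. Poly_Mapping.keys K \<subseteq> {1..n} \<Longrightarrow> T (mmono K) = T' (mmono K)"
  shows "T f = T' (f :: 'a::comm_ring_1 mfps)"
proof (rule mfps_eqI_order)
  fix d
  obtain c c' where c: "\<And>d f. order_ge (d + c) f \<Longrightarrow> order_ge d (T f)"
      "\<And>d f. order_ge (d + c') f \<Longrightarrow> order_ge d (T' f)"
    using assms unfolding cont_linear_def by meson
  define p where "p = (\<Sum>K\<in>exps n (d + c + c'). mconst (mcoeff f K) * mmono K)"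
  have "order_ge (d + c + c') (f - p)"
    using order_ge_truncation[OF f, of "d + c + c'"] by (auto simp: p_def intro: order_ge_mono)
  then have o: "order_ge d (T (f - p))" "order_ge d (T' (f - p))"
    by (auto intro!: c intro: order_ge_mono)
  have "T p = T' p"
    unfolding p_def cont_linear_sum_apply[OF T finite_exps] cont_linear_sum_apply[OF T' finite_exps]
    using T T' by (intro sum.cong) (auto simp: cont_linear_def mono exps_def)
  moreover have "T f = T (f - p) + T p" "T' f = T' (f - p) + T' p"
    using T T' unfolding cont_linear_def by (metis diff_add_cancel)+
  ultimately have "T f - T' f = T (f - p) - T' (f - p)" by simp
  with o show "order_ge d (T f - T' f)" by (simp add: order_ge_diff)
qed

definition mprod :: "nat \<Rightarrow> (nat \<Rightarrow> 'a::comm_ring_1 mfps) \<Rightarrow> (nat \<Rightarrow>\<^sub>0 nat) \<Rightarrow> 'a mfps" where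
  "mprod n H Q = (\<Prod>i=1..n. H i ^ Poly_Mapping.lookup Q i)"

lemma mprod_0 [simp]: "mprod n H 0 = 1"
  by (simp add: mprod_def)

lemma mprod_add: "mprod n H (P + Q) = mprod n H P * mprod n H Q"
  by (simp add: mprod_def lookup_add power_add prod.distrib)

lemma mprod_single [simp]: "i \<in> {1..n} \<Longrightarrow> mprod n H (Poly_Mapping.single i 1) = H i"
  by (simp add: mprod_def lookup_single when_def if_distrib[of "\<lambda>k. _ ^ k"] prod.delta cong: if_cong)

lemma order_ge_mprod:
  assumes "\<forall>i\<in>{1..n}. order_ge 1 (H i)" "Poly_Mapping.keys Q \<subseteq> {1..n}"
  shows "order_ge (tdeg Q) (mprod n H Q)"
  unfolding mprod_def tdeg_eq_sum[OF finite_atLeastAtMost assms(2)]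
  using assms(1) by (intro order_ge_prod order_ge_power) auto

lemma in_vars_mprod:
  assumes "\<forall>i\<in>{1..n}. in_vars V (H i)"
  shows "in_vars V (mprod n H Q)"
  unfolding mprod_def using assms by (intro in_vars_prod in_vars_power) auto

lemma mcoeff_msubst:
  "mcoeff (msubst n f H) K = (\<Sum>Q\<in>exps n (tdeg K). mcoeff f Q * mcoeff (mprod n H Q) K)"
  by (simp add: msubst_def exps_def mprod_def)

lemma msubst_arith:
  "msubst n 0 H = (0 :: 'a::comm_ring_1 mfps)"
  "msubst n (f + g) H = msubst n f H + (msubst n g H :: 'a mfps)"
  "msubst n (f - g) H = msubst n f H - (msubst n g H :: 'a mfps)"
  "msubst n (mconst c * f) H = mconst c * (msubst n f H :: 'a mfps)"
  by (rule mfps_eqI; simp add: mcoeff_msubst sum.distrib sum_subtractf distrib_right left_diff_distrib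
      sum_distrib_left mult.assoc)+

lemma order_ge_msubst: "order_ge d f \<Longrightarrow> order_ge d (msubst n f H)"
  unfolding order_ge_def mcoeff_msubst exps_def by (intro allI impI sum.neutral) auto

lemma cont_linear_msubst: "cont_linear (\<lambda>f. msubst n f H)"
  unfolding cont_linear_def by (auto simp: msubst_arith intro!: exI[of _ 0] order_ge_msubst)

lemma in_vars_msubst:
  assumes "\<forall>i\<in>{1..n}. in_vars V (H i)"
  shows "in_vars V (msubst n f H)"
  unfolding in_vars_def mcoeff_msubst
proof (intro allI impI)
  fix K assume "(\<Sum>Q\<in>exps n (tdeg K). mcoeff f Q * mcoeff (mprod n H Q) K) \<noteq> 0"
  then obtain Q where "mcoeff f Q * mcoeff (mprod n H Q) K \<noteq> 0"
    by (elim sum.not_neutral_contains_not_neutral)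
  then have "mcoeff (mprod n H Q) K \<noteq> 0" by auto
  then show "Poly_Mapping.keys K \<subseteq> V"
    using in_vars_mprod[OF assms] by (auto simp: in_vars_def)
qed

lemma msubst_mmono:
  assumes "\<forall>i\<in>{1..n}. order_ge 1 (H i)" "Poly_Mapping.keys Q \<subseteq> {1..n}"
  shows "msubst n (mmono Q) H = mprod n H Q"
proof (rule mfps_eqI)
  fix K
  have "mcoeff (msubst n (mmono Q) H) K = (if Q \<in> exps n (tdeg K) then mcoeff (mprod n H Q) K else 0)"
    by (simp add: mcoeff_msubst if_distrib[of "\<lambda>x. x * _"] sum.delta cong: if_cong)
  then show "mcoeff (msubst n (mmono Q) H) K = mcoeff (mprod n H Q) K"
    using order_ge_mprod[OF assms] assms(2) by (auto simp: exps_def order_ge_def)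
qed

lemma msubst_mvar:
  assumes "\<forall>i\<in>{1..n}. order_ge 1 (H i)" "i \<in> {1..n}"
  shows "msubst n (mvar i) H = H i"
  using msubst_mmono[OF assms(1), of "Poly_Mapping.single i 1"] assms(2) by (simp add: mvar_eq_mmono)

lemma msubst_1:
  assumes "\<forall>i\<in>{1..n}. order_ge 1 (H i)"
  shows "msubst n 1 H = 1"
  using msubst_mmono[OF assms, of 0] by (simp add: mmono_0)

text \<open>
  Both sides are bilinear and continuous, so this follows from \<open>mprod_add\<close> by checking first the
  one and then the other factor on monomials.
\<close>

lemma msubst_mult:
  assumes H: "\<forall>i\<in>{1..n}. order_ge 1 (H i)" and f: "in_vars {1..n} f" and g: "in_vars {1..n} g"
  shows "msubst n (f * g) H = msubst n f H * msubst n g H"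
proof -
  have "msubst n (f * mmono R) H = msubst n f H * mprod n H R" if R: "Poly_Mapping.keys R \<subseteq> {1..n}" for R
  proof (rule cont_linear_eqI[OF f])
    show "cont_linear (\<lambda>f. msubst n (f * mmono R) H)"
      by (rule cont_linear_compose[OF cont_linear_msubst cont_linear_mult[OF cont_linear_ident]])
    show "cont_linear (\<lambda>f. msubst n f H * mprod n H R)"
      by (rule cont_linear_mult[OF cont_linear_msubst])
  qed (use R in \<open>simp add: mmono_add[symmetric] msubst_mmono[OF H] keys_add_nat mprod_add\<close>)
  then have "msubst n (mmono R * f) H = mprod n H R * msubst n f H"
    if "Poly_Mapping.keys R \<subseteq> {1..n}" for R
    using that by (simp add: mult.commute)
  note mono = this
  have "msubst n (g * f) H = msubst n g H * msubst n f H"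
  proof (rule cont_linear_eqI[OF g])
    show "cont_linear (\<lambda>g. msubst n (g * f) H)"
      by (rule cont_linear_compose[OF cont_linear_msubst cont_linear_mult[OF cont_linear_ident]])
    show "cont_linear (\<lambda>g. msubst n g H * msubst n f H)"
      by (rule cont_linear_mult[OF cont_linear_msubst])
  qed (simp add: mono msubst_mmono[OF H])
  then show ?thesis by (simp add: mult.commute)
qed

lemma msubst_prod:
  assumes H: "\<forall>i\<in>{1..n}. order_ge 1 (H i)" and f: "\<And>a. a \<in> A \<Longrightarrow> in_vars {1..n} (f a)"
  shows "msubst n (\<Prod>a\<in>A. f a) H = (\<Prod>a\<in>A. msubst n (f a) H)"
  using f by (induction A rule: infinite_finite_induct) (auto simp: msubst_1[OF H] msubst_mult[OF H] in_vars_prod)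

lemma msubst_power:
  assumes H: "\<forall>i\<in>{1..n}. order_ge 1 (H i)" and f: "in_vars {1..n} f"
  shows "msubst n (f ^ k) H = msubst n f H ^ k"
  by (induction k) (auto simp: msubst_1[OF H] msubst_mult[OF H] f in_vars_power)

lemma msubst_sum:
  "msubst n (\<Sum>a\<in>A. f a) H = (\<Sum>a\<in>A. msubst n (f a) H :: 'a::comm_ring_1 mfps)"
  by (induction A rule: infinite_finite_induct) (auto simp: msubst_arith)

lemma order_ge_1_msubst: "\<forall>i\<in>{1..n}. order_ge 1 (H i) \<Longrightarrow> \<forall>i\<in>{1..n}. order_ge 1 (msubst n (H i) K)"
  by (auto intro: order_ge_msubst)

lemma msubst_assoc:
  assumes H: "\<forall>i\<in>{1..n}. order_ge 1 (H i)" "\<forall>i\<in>{1..n}. in_vars {1..n} (H i)"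
    and K: "\<forall>i\<in>{1..n}. order_ge 1 (K i)"
    and f: "in_vars {1..n} f"
  shows "msubst n (msubst n f H) K = msubst n f (\<lambda>i. msubst n (H i) K)"
proof (rule cont_linear_eqI[OF f])
  show "cont_linear (\<lambda>f. msubst n (msubst n f H) K)"
    by (rule cont_linear_compose[OF cont_linear_msubst cont_linear_msubst])
  show "cont_linear (\<lambda>f. msubst n f (\<lambda>i. msubst n (H i) K))"
    by (rule cont_linear_msubst)
next
  fix Q :: "nat \<Rightarrow>\<^sub>0 nat" assume Q: "Poly_Mapping.keys Q \<subseteq> {1..n}"
  have "msubst n (mprod n H Q) K = mprod n (\<lambda>i. msubst n (H i) K) Q"
    unfolding mprod_def using H(2)
    by (subst msubst_prod[OF K]) (auto intro: in_vars_power simp: msubst_power[OF K])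
  then show "msubst n (msubst n (mmono Q) H) K = msubst n (mmono Q) (\<lambda>i. msubst n (H i) K)"
    using msubst_mmono[OF H(1) Q] msubst_mmono[OF order_ge_1_msubst[OF H(1)] Q] by simp
qed

text \<open>
  The chain rule. On monomials it follows by induction, since both sides obey the product rule.
\<close>

lemma mderiv_msubst:
  assumes H: "\<forall>i\<in>{1..n}. order_ge 1 (H i)" and f: "in_vars {1..n} f"
  shows "mderiv m (msubst n f H) = (\<Sum>j=1..n. msubst n (mderiv j f) H * mderiv m (H j))"
proof (rule cont_linear_eqI[OF f])
  show "cont_linear (\<lambda>f. mderiv m (msubst n f H))"
    by (rule cont_linear_compose[OF cont_linear_mderiv cont_linear_msubst])
  show "cont_linear (\<lambda>f. \<Sum>j=1..n. msubst n (mderiv j f) H * mderiv m (H j))"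
    by (intro cont_linear_sum cont_linear_mult cont_linear_compose[OF cont_linear_msubst cont_linear_mderiv]) auto
next
  fix Q :: "nat \<Rightarrow>\<^sub>0 nat" assume "Poly_Mapping.keys Q \<subseteq> {1..n}"
  then show "mderiv m (msubst n (mmono Q) H) = (\<Sum>j=1..n. msubst n (mderiv j (mmono Q)) H * mderiv m (H j))"
  proof (induction rule: exponent_induct)
    case zero
    then show ?case by (simp add: mmono_0 msubst_1[OF H] msubst_arith)
  next
    case (add L i)
    let ?s = "\<lambda>f. msubst n f H"
    have iv: "in_vars {1..n} (mmono L :: 'a mfps)" "in_vars {1..n} (mvar i :: 'a mfps)"
      using add by (auto intro: in_vars_mmono in_vars_mvar)
    then have iv': "in_vars {1..n} (mderiv j (mmono L) :: 'a mfps)"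
      "in_vars {1..n} (mderiv j (mvar i) :: 'a mfps)" for j
      by (blast intro: in_vars_mderiv)+
    have "(\<Sum>j=1..n. ?s (mderiv j (mvar i)) * mderiv m (H j)) =
        (\<Sum>j=1..n. if i = j then mderiv m (H j) else 0)"
      by (intro sum.cong) (auto simp: msubst_1[OF H] msubst_arith)
    also have "\<dots> = mderiv m (H i)"
      using add(1) by (simp add: sum.delta')
    finally have v: "(\<Sum>j=1..n. ?s (mderiv j (mvar i)) * mderiv m (H j)) = mderiv m (H i)" .
    have "(\<Sum>j=1..n. ?s (mderiv j (mmono L * mvar i)) * mderiv m (H j)) =
        (\<Sum>j=1..n. ?s (mderiv j (mmono L)) * mderiv m (H j)) * ?s (mvar i) +
        ?s (mmono L) * (\<Sum>j=1..n. ?s (mderiv j (mvar i)) * mderiv m (H j))"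
      unfolding mderiv_mult msubst_arith sum_distrib_left sum_distrib_right sum.distrib[symmetric]
      using iv iv' by (intro sum.cong) (simp_all add: msubst_mult[OF H] algebra_simps del: mderiv_mvar)
    also have "\<dots> = mderiv m (?s (mmono L)) * ?s (mvar i) + ?s (mmono L) * mderiv m (?s (mvar i))"
      using add v by (simp add: msubst_mvar[OF H] del: mderiv_mvar)
    also have "\<dots> = mderiv m (?s (mmono L * mvar i))"
      using iv by (simp add: msubst_mult[OF H] mderiv_mult)
    finally show ?case by (simp add: mmono_add mvar_eq_mmono)
  qed
qed

section \<open>Solving formal fixed point equations degree by degree\<close>

text \<open>
  If $\<Phi>$ turns agreement up to degree $d$ into agreement up to degree $d + 1$, the iterates of $\<Phi>$ on
  $0$ stabilize in each degree. Contractivity is only required on the families whose coefficients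
  are supported in $R$: the substitutions below lose it for series with a constant term. The same
  support condition carries resonance over to the fixed point.
\<close>

lemma formal_fixed_point:
  fixes \<Phi> :: "(nat \<Rightarrow> 'a::comm_ring_1 mfps) \<Rightarrow> nat \<Rightarrow> 'a mfps"
    and R :: "nat \<Rightarrow> (nat \<Rightarrow>\<^sub>0 nat) \<Rightarrow> bool"
  defines "adm \<equiv> \<lambda>f. \<forall>i K. mcoeff (f i) K \<noteq> 0 \<longrightarrow> R i K"
  assumes contr: "\<And>f g d i. adm f \<Longrightarrow> adm g \<Longrightarrow> (\<And>i. order_ge d (f i - g i)) \<Longrightarrow>
      order_ge (Suc d) (\<Phi> f i - \<Phi> g i)"
    and adm: "\<And>f. adm f \<Longrightarrow> adm (\<Phi> f)"
  shows "\<exists>f. \<Phi> f = f \<and> (\<forall>i K. mcoeff (f i) K \<noteq> 0 \<longrightarrow> R i K)"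
proof -
  define S where "S m = (\<Phi> ^^ m) (\<lambda>_. 0)" for m
  have S_Suc: "S (Suc m) = \<Phi> (S m)" for m by (simp add: S_def)
  have adm_S: "adm (S m)" for m
  proof (induction m)
    case 0
    then show ?case by (simp add: S_def adm_def)
  next
    case (Suc m)
    then show ?case unfolding S_Suc by (rule adm)
  qed
  have step: "order_ge m (S (Suc m) i - S m i)" for m i
  proof (induction m arbitrary: i)
    case (Suc m)
    show ?case
      using contr[OF adm_S adm_S, of m "Suc m" m i] Suc by (simp only: S_Suc)
  qed simp
  have stable: "order_ge m (S m' i - S m i)" if "m \<le> m'" for m m' i
    using that
  proof (induction m' rule: dec_induct)
    case (step k)
    have "order_ge m (S (Suc k) i - S k i)"
      using order_ge_mono[OF \<open>\<And>m i. order_ge m (S (Suc m) i - S m i)\<close>] step by simp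
    from order_ge_add[OF this step.IH] show ?case by simp
  qed simp
  define f where "f i = Abs_mfps (\<lambda>K. mcoeff (S (Suc (tdeg K)) i) K)" for i
  have f: "order_ge m (f i - S m i)" for m i
    unfolding order_ge_def
  proof (intro allI impI)
    fix K assume "tdeg K < m"
    then have "order_ge (Suc (tdeg K)) (S m i - S (Suc (tdeg K)) i)"
      by (intro stable) simp
    then show "mcoeff (f i - S m i) K = 0"
      by (simp add: order_ge_def f_def)
  qed
  have adm_f: "adm f"
    using adm_S unfolding adm_def f_def by simp
  have "\<Phi> f i = f i" for i
  proof (rule mfps_eqI_order)
    fix d
    have "order_ge (Suc d) (\<Phi> f i - S (Suc d) i)"
      unfolding S_Suc by (rule contr[OF adm_f adm_S f])
    from order_ge_diff[OF this f[of "Suc d" i]] have "order_ge (Suc d) (\<Phi> f i - f i)" by simp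
    then show "order_ge d (\<Phi> f i - f i)" by (rule order_ge_mono) simp
  qed
  then show ?thesis
    using adm_f by (intro exI[of _ f]) (auto simp: adm_def)
qed

text \<open>
  Exchanging one factor at a time, each term of the difference has a factor $H_i - H'_i$ of order $d$
  and $|Q| - 1$ further factors of order $1$.
\<close>

lemma order_ge_mprod_diff:
  assumes H: "\<forall>i\<in>{1..n}. order_ge 1 (H i)" "\<forall>i\<in>{1..n}. order_ge 1 (H' i)"
    and d: "\<forall>i\<in>{1..n}. order_ge d (H i - H' i)"
    and Q: "Poly_Mapping.keys Q \<subseteq> {1..n}" "tdeg Q = Suc k"
  shows "order_ge (d + k) (mprod n H Q - mprod n H' Q)"
  using Q
proof (induction arbitrary: k rule: exponent_induct)
  case (add L i)
  have k: "k = tdeg L" using add.prems by simp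
  have "order_ge (d + k) ((mprod n H L - mprod n H' L) * H i)"
  proof (cases "tdeg L")
    case (Suc k')
    have "order_ge (d + k' + 1) ((mprod n H L - mprod n H' L) * H i)"
      using add.IH[OF Suc] H(1) add.hyps by (intro order_ge_mult) auto
    then show ?thesis using k Suc by (simp add: Suc_eq_plus1 add.assoc)
  qed simp
  moreover have "order_ge (k + d) (mprod n H' L * (H i - H' i))"
    unfolding k using d add.hyps by (intro order_ge_mult order_ge_mprod[OF H(2)]) auto
  ultimately have "order_ge (d + k) ((mprod n H L - mprod n H' L) * H i + mprod n H' L * (H i - H' i))"
    by (intro order_ge_add) (simp_all add: add.commute)
  then show ?case
    using add.hyps by (simp add: mprod_add algebra_simps)
qed simp

text \<open>
  A series without linear terms gains one degree: its monomials have at least two factors, one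
  of which is left beside the difference.
\<close>

lemma order_ge_msubst_diff:
  assumes H: "\<forall>i\<in>{1..n}. order_ge 1 (H i)" "\<forall>i\<in>{1..n}. order_ge 1 (H' i)"
    and d: "\<forall>i\<in>{1..n}. order_ge d (H i - H' i)"
    and f: "order_ge 2 f"
  shows "order_ge (Suc d) (msubst n f H - msubst n f H')"
  unfolding order_ge_def
proof (intro allI impI)
  fix K assume K: "tdeg K < Suc d"
  have "mcoeff f Q * (mcoeff (mprod n H Q) K - mcoeff (mprod n H' Q) K) = 0"
    if Q: "Q \<in> exps n (tdeg K)" for Q
  proof (cases "tdeg Q < 2")
    case True
    then show ?thesis using f by (simp add: order_ge_def)
  next
    case False
    then obtain k where k: "tdeg Q = Suc k" "1 \<le> k"
      by (metis One_nat_def Suc_leI less_2_cases_iff not_less_eq not_less_zero old.nat.exhaust)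
    then have "order_ge (d + k) (mprod n H Q - mprod n H' Q)"
      using Q by (intro order_ge_mprod_diff[OF H d]) (auto simp: exps_def)
    then show ?thesis using K k by (simp add: order_ge_def)
  qed
  then show "mcoeff (msubst n f H - msubst n f H') K = 0"
    by (simp add: mcoeff_msubst sum_subtractf[symmetric] right_diff_distrib[symmetric])
qed


section \<open>Weights and resonances\<close>

text \<open>
  The pairing $\langle K, \<lambda> \rangle$ for exponents of monomials; $x^K$ is resonant in the $i$-th component when it
  equals $\<lambda>_i$.
\<close>

definition wt :: "nat \<Rightarrow> (nat \<Rightarrow> complex) \<Rightarrow> (nat \<Rightarrow>\<^sub>0 nat) \<Rightarrow> complex" where
  "wt n lam K = (\<Sum>i=1..n. of_nat (Poly_Mapping.lookup K i) * lam i)"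

lemma wt_0 [simp]: "wt n lam 0 = 0"
  by (simp add: wt_def)

lemma wt_add: "wt n lam (P + Q) = wt n lam P + wt n lam Q"
  by (simp add: wt_def lookup_add distrib_right sum.distrib)

lemma wt_single [simp]: "i \<in> {1..n} \<Longrightarrow> wt n lam (Poly_Mapping.single i 1) = lam i"
  by (simp add: wt_def lookup_single when_def if_distrib[of "\<lambda>k. of_nat k * _"] sum.delta cong: if_cong)

text \<open>
  Quasihomogeneity of weight $\<mu>$, that is, being an eigenvector of the derivation
  $\sum_j \<lambda>_j x_j \partial_j$. A field is in normal form when its $i$-th component has weight $\<lambda>_i$.
\<close>

definition homog :: "nat \<Rightarrow> (nat \<Rightarrow> complex) \<Rightarrow> complex \<Rightarrow> complex mfps \<Rightarrow> bool" where
  "homog n lam \<mu> f \<longleftrightarrow> (\<forall>K. mcoeff f K \<noteq> 0 \<longrightarrow> Poly_Mapping.keys K \<subseteq> {1..n} \<and> wt n lam K = \<mu>)"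

lemma homog_imp_in_vars: "homog n lam \<mu> f \<Longrightarrow> in_vars {1..n} f"
  by (auto simp: homog_def in_vars_def)

lemma homog_0 [simp]: "homog n lam \<mu> 0"
  by (simp add: homog_def)

lemma homog_1 [simp]: "homog n lam 0 1"
  by (simp add: homog_def)

lemma homog_mvar: "i \<in> {1..n} \<Longrightarrow> homog n lam (lam i) (mvar i)"
  by (simp add: homog_def mcoeff_mvar)

lemma homog_add: "homog n lam \<mu> f \<Longrightarrow> homog n lam \<mu> g \<Longrightarrow> homog n lam \<mu> (f + g)"
  unfolding homog_def by (metis add.right_neutral mcoeff_arith(3))

lemma homog_uminus: "homog n lam \<mu> f \<Longrightarrow> homog n lam \<mu> (- f)"
  by (simp add: homog_def)

lemma homog_diff: "homog n lam \<mu> f \<Longrightarrow> homog n lam \<mu> g \<Longrightarrow> homog n lam \<mu> (f - g)"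
  using homog_add[of n lam \<mu> f "- g"] by (simp add: homog_uminus)

lemma homog_sum: "(\<And>a. a \<in> A \<Longrightarrow> homog n lam \<mu> (f a)) \<Longrightarrow> homog n lam \<mu> (\<Sum>a\<in>A. f a)"
  by (induction A rule: infinite_finite_induct) (auto intro: homog_add)

lemma homog_mult:
  assumes "homog n lam \<mu> f" "homog n lam \<nu> g"
  shows "homog n lam (\<mu> + \<nu>) (f * g)"
  unfolding homog_def
proof (intro allI impI)
  fix K assume "mcoeff (f * g) K \<noteq> 0"
  then obtain P Q where PQ: "P + Q = K" "mcoeff f P * mcoeff g Q \<noteq> 0"
    unfolding mcoeff_mult by (elim sum.not_neutral_contains_not_neutral) (auto simp: splits_def)
  then have "mcoeff f P \<noteq> 0" "mcoeff g Q \<noteq> 0" by auto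
  with assms show "Poly_Mapping.keys K \<subseteq> {1..n} \<and> wt n lam K = \<mu> + \<nu>"
    unfolding homog_def PQ(1)[symmetric] by (metis Un_least keys_add_nat wt_add)
qed

lemma homog_mprod:
  assumes "\<forall>i\<in>{1..n}. homog n lam (lam i) (H i)" "Poly_Mapping.keys Q \<subseteq> {1..n}"
  shows "homog n lam (wt n lam Q) (mprod n H Q)"
  using assms(2)
  by (induction rule: exponent_induct) (use assms(1) in \<open>auto simp: mprod_add wt_add intro!: homog_mult\<close>)

lemma homog_msubst:
  assumes H: "\<forall>i\<in>{1..n}. homog n lam (lam i) (H i)" and f: "homog n lam \<mu> f"
  shows "homog n lam \<mu> (msubst n f H)"
  unfolding homog_def mcoeff_msubst
proof (intro allI impI)
  fix K assume "(\<Sum>Q\<in>exps n (tdeg K). mcoeff f Q * mcoeff (mprod n H Q) K) \<noteq> 0"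
  then obtain Q where "mcoeff f Q * mcoeff (mprod n H Q) K \<noteq> 0"
    by (elim sum.not_neutral_contains_not_neutral)
  then have "mcoeff f Q \<noteq> 0" "mcoeff (mprod n H Q) K \<noteq> 0" by auto
  then show "Poly_Mapping.keys K \<subseteq> {1..n} \<and> wt n lam K = \<mu>"
    using f homog_mprod[OF H, of Q] by (auto simp: homog_def)
qed

lemma homog_mderiv:
  assumes "homog n lam \<mu> f" "j \<in> {1..n}"
  shows "homog n lam (\<mu> - lam j) (mderiv j f)"
  unfolding homog_def
proof (intro allI impI)
  fix K assume "mcoeff (mderiv j f) K \<noteq> 0"
  then have "mcoeff f (K + Poly_Mapping.single j 1) \<noteq> 0" by auto
  then have "Poly_Mapping.keys (K + Poly_Mapping.single j 1) \<subseteq> {1..n}"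
    "wt n lam (K + Poly_Mapping.single j 1) = \<mu>"
    using assms by (auto simp only: homog_def)
  then show "Poly_Mapping.keys K \<subseteq> {1..n} \<and> wt n lam K = \<mu> - lam j"
    using assms(2) by (auto simp: keys_add_nat wt_add)
qed

lemma mcoeff_mvar_mult_mderiv:
  "mcoeff (mvar j * mderiv j f) K = of_nat (Poly_Mapping.lookup K j) * mcoeff (f :: 'a::comm_ring_1 mfps) K"
proof (cases "Poly_Mapping.lookup K j = 0")
  case True
  then show ?thesis by (simp add: mcoeff_mvar_mult_eq_0)
next
  case False
  then obtain L where "K = L + Poly_Mapping.single j 1" by (rule exponent_decrease)
  then show ?thesis by (simp add: lookup_add add.commute)
qed

lemma mcoeff_euler:
  "mcoeff (\<Sum>j=1..m. mconst (lam j) * (mvar j * mderiv j f)) K = wt m lam K * mcoeff f K"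
  by (simp add: mcoeff_mvar_mult_mderiv wt_def sum_distrib_right) (intro sum.cong, simp_all)

lemma euler_identity:
  assumes "homog n lam \<mu> f"
  shows "(\<Sum>j=1..n. mconst (lam j) * (mvar j * mderiv j f)) = mconst \<mu> * f"
  by (rule mfps_eqI) (use assms in \<open>auto simp only: homog_def mcoeff_euler mcoeff_mconst_mult mult_cancel_right\<close>)

definition weight_part :: "nat \<Rightarrow> (nat \<Rightarrow> complex) \<Rightarrow> complex \<Rightarrow> complex mfps \<Rightarrow> complex mfps" where
  "weight_part n lam \<mu> f = Abs_mfps (\<lambda>K. if wt n lam K = \<mu> then mcoeff f K else 0)"

lemma mcoeff_weight_part [simp]:
  "mcoeff (weight_part n lam \<mu> f) K = (if wt n lam K = \<mu> then mcoeff f K else 0)"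
  by (simp add: weight_part_def)

lemma order_ge_weight_part: "order_ge d f \<Longrightarrow> order_ge d (weight_part n lam \<mu> f)"
  by (simp add: order_ge_def)

lemma homog_weight_part: "in_vars {1..n} f \<Longrightarrow> homog n lam \<mu> (weight_part n lam \<mu> f)"
  by (auto simp: in_vars_def homog_def)

lemma weight_part_homog: "homog n lam \<mu> f \<Longrightarrow> weight_part n lam \<mu> f = f"
  by (rule mfps_eqI) (auto simp: homog_def)

lemma weight_part_arith:
  "weight_part n lam \<mu> (f + g) = weight_part n lam \<mu> f + weight_part n lam \<mu> g"
  "weight_part n lam \<mu> (f - g) = weight_part n lam \<mu> f - weight_part n lam \<mu> g"
  "weight_part n lam \<mu> (mconst c * f) = mconst c * weight_part n lam \<mu> f"
  "weight_part n lam \<mu> 0 = 0"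
  by (rule mfps_eqI; simp)+

lemma weight_part_sum: "weight_part n lam \<mu> (\<Sum>a\<in>A. f a) = (\<Sum>a\<in>A. weight_part n lam \<mu> (f a))"
  by (induction A rule: infinite_finite_induct) (auto simp: weight_part_arith)

text \<open>
  Multiplication by $g$ shifts all weights by $\<nu>$, hence it shifts the weight components.
\<close>

lemma weight_part_mult_homog:
  assumes "homog n lam \<nu> g"
  shows "weight_part n lam (\<mu> + \<nu>) (f * g) = weight_part n lam \<mu> f * g"
proof (rule mfps_eqI)
  fix K
  have "(if wt n lam K = \<mu> + \<nu> then mcoeff f P * mcoeff g Q else 0) =
      (if wt n lam P = \<mu> then mcoeff f P else 0) * mcoeff g Q" if "P + Q = K" for P Q
    using assms that[symmetric] by (cases "mcoeff g Q = 0") (auto simp: homog_def wt_add)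
  then have "(\<Sum>(P, Q)\<in>splits K. if wt n lam K = \<mu> + \<nu> then mcoeff f P * mcoeff g Q else 0) =
      (\<Sum>(P, Q)\<in>splits K. (if wt n lam P = \<mu> then mcoeff f P else 0) * mcoeff g Q)"
    by (intro sum.cong) (auto simp: splits_def)
  then show "mcoeff (weight_part n lam (\<mu> + \<nu>) (f * g)) K = mcoeff (weight_part n lam \<mu> f * g) K"
    by (cases "wt n lam K = \<mu> + \<nu>") (simp_all add: mcoeff_mult)
qed

lemma weight_part_mderiv:
  assumes "j \<in> {1..n}"
  shows "weight_part n lam (\<mu> - lam j) (mderiv j f) = mderiv j (weight_part n lam \<mu> f)"
  by (rule mfps_eqI) (use assms in \<open>auto simp: wt_add\<close>)

lemma in_normal_form_iff:
  "in_normal_form n lam F \<longleftrightarrow> (\<forall>i\<in>{1..n}. homog n lam (lam i) (F i))"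
proof
  assume nf: "in_normal_form n lam F"
  show "\<forall>i\<in>{1..n}. homog n lam (lam i) (F i)"
    unfolding homog_def
  proof (intro ballI allI impI)
    fix i K assume i: "i \<in> {1..n}" and K: "mcoeff (F i) K \<noteq> 0"
    have keys: "Poly_Mapping.keys K \<subseteq> {1..n}"
      using nf i K by (auto simp: in_normal_form_def formal_field_def in_vars_def)
    define Q where "Q = Poly_Mapping.map int K - Poly_Mapping.single i 1"
    have lk: "Poly_Mapping.lookup Q j = int (Poly_Mapping.lookup K j) - (if j = i then 1 else 0)" for j
      by (auto simp: Q_def lookup_minus lookup_single map.rep_eq when_def)
    have "Poly_Mapping.keys Q \<subseteq> {1..n}"
    proof
      fix j assume "j \<in> Poly_Mapping.keys Q"
      then have "j = i \<or> j \<in> Poly_Mapping.keys K"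
        by (auto simp: in_keys_iff lk split: if_splits)
      then show "j \<in> {1..n}" using keys i by blast
    qed
    then have Q: "Q \<in> NN_comp n i"
      by (auto simp: NN_comp_def lk)
    then have "Q \<in> NN n" using i by (auto simp: NN_def)
    moreover have "Poly_Mapping.map nat (Q + Poly_Mapping.single i 1) = K"
      by (rule poly_mapping_eqI) (auto simp: lk map.rep_eq lookup_add lookup_single when_def)
    then have "field_coeff n F Q i \<noteq> 0"
      using Q K by (simp add: field_coeff_def)
    ultimately have "pairing n Q lam = 0"
      using nf i by (auto simp: in_normal_form_def)
    moreover have "pairing n Q lam = wt n lam K - lam i"
      using i by (simp add: pairing_def wt_def lk left_diff_distrib sum_subtractf
          if_distrib[of of_int] if_distrib[of "\<lambda>x. x * _"] sum.delta cong: if_cong)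
    ultimately show "Poly_Mapping.keys K \<subseteq> {1..n} \<and> wt n lam K = lam i"
      using keys by simp
  qed
next
  assume h: "\<forall>i\<in>{1..n}. homog n lam (lam i) (F i)"
  show "in_normal_form n lam F"
    unfolding in_normal_form_def formal_field_def
  proof (intro conjI ballI impI)
    fix Q i assume Q: "pairing n Q lam \<noteq> 0" and i: "i \<in> {1..n}"
    show "field_coeff n F Q i = 0"
    proof (rule ccontr)
      assume ne: "field_coeff n F Q i \<noteq> 0"
      then have QN: "Q \<in> NN_comp n i" by (auto simp: field_coeff_def split: if_splits)
      define K where "K = Poly_Mapping.map nat (Q + Poly_Mapping.single i 1)"
      have "mcoeff (F i) K \<noteq> 0" using ne QN by (simp add: field_coeff_def K_def)
      then have "wt n lam K = lam i" using h i by (auto simp: homog_def)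
      moreover have lk: "of_nat (Poly_Mapping.lookup K j) =
          (of_int (Poly_Mapping.lookup Q j) + (if j = i then 1 else 0) :: complex)"
        if "j \<in> {1..n}" for j
      proof -
        have "int (Poly_Mapping.lookup K j) = Poly_Mapping.lookup Q j + (if j = i then 1 else 0)"
          using QN that by (auto simp: K_def map.rep_eq lookup_add lookup_single when_def NN_comp_def)
        from arg_cong[OF this, of "of_int :: int \<Rightarrow> complex"] show ?thesis
          by (simp split: if_splits)
      qed
      have "wt n lam K = pairing n Q lam + lam i"
        unfolding wt_def pairing_def using i
        by (simp add: lk distrib_right sum.distrib if_distrib[of "\<lambda>x. x * _"] sum.delta cong: if_cong)
      ultimately show False using Q by simp
    qed
  qed (use h in \<open>auto intro: homog_imp_in_vars\<close>)
qed

section \<open>Distinguished normal forms\<close>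

text \<open>
  The real part of the weight of $x^P$ is $\sum_{i>l} p_i\,\mathrm{Re}\,\<lambda>_i$ with positive coefficients, so a
  monomial of imaginary weight does not involve $x_{l+1}, \dots, x_n$.
\<close>

lemma mderiv_eq_0_if_weight_imaginary:
  assumes re0: "\<And>j. j \<in> {1..l} \<Longrightarrow> Re (lam j) = 0" and pos: "\<And>j. j \<in> {l+1..n} \<Longrightarrow> Re (lam j) > 0"
    and f: "homog n lam \<mu> f" and \<mu>: "Re \<mu> = 0" and j: "j \<in> {l+1..n}"
  shows "mderiv j f = 0"
proof (rule mfps_eqI)
  fix K
  show "mcoeff (mderiv j f) K = mcoeff 0 K"
  proof (rule ccontr)
    assume "mcoeff (mderiv j f) K \<noteq> mcoeff 0 K"
    moreover define L where "L = K + Poly_Mapping.single j 1"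
    ultimately have "mcoeff f L \<noteq> 0" by auto
    then have "wt n lam L = \<mu>" using f by (auto simp: homog_def)
    then have "(\<Sum>i=1..n. real (Poly_Mapping.lookup L i) * Re (lam i)) = 0"
      using \<mu> by (auto simp: wt_def)
    moreover have nn: "0 \<le> real (Poly_Mapping.lookup L i) * Re (lam i)" if "i \<in> {1..n}" for i
      using re0[of i] pos[of i] that by (cases "i \<le> l") auto
    ultimately have "real (Poly_Mapping.lookup L j) * Re (lam j) = 0"
      using j by (subst (asm) sum_nonneg_eq_0_iff) auto
    then show False
      using pos[OF j] by (simp add: L_def lookup_add)
  qed
qed

text \<open>
  Given any transformation $H_0 = x + h_0$ to normal form $G_0$, a resonant $K = y + k$ is sought such
  that $H_0 \circ K = y + (k + h_0 \circ K)$ has no resonant terms, i.e. $k_i = -[h_{0,i} \circ (y + k)]_{res}$. The new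
  field is determined by $DK \cdot G = G_0 \circ K$, i.e. $G_i = G_{0,i} \circ K - \sum_j \partial_j k_i\, G_j$. Both
  equations are contractive because $h_0$ and $k$ have order two.
\<close>

theorem distinguished_normal_form:
  fixes n l :: nat and lam :: "nat \<Rightarrow> complex" and F G0 H0 :: "nat \<Rightarrow> complex mfps" and a :: "complex mfps"
  assumes F: "\<forall>i\<in>{1..n}. in_vars {1..n} (F i)"
    and H0: "transformation n H0" "transforms_to n H0 F G0"
    and G0: "\<forall>i\<in>{1..n}. homog n lam (lam i) (G0 i)"
    and l: "l \<le> n"
    and re0: "\<And>j. j \<in> {1..l} \<Longrightarrow> Re (lam j) = 0" and pos: "\<And>j. j \<in> {l+1..n} \<Longrightarrow> Re (lam j) > 0"
    and a: "in_vars {1..n} a" "mcoeff a 0 = 1"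
    and G0a: "\<forall>i\<in>{1..l}. G0 i = mconst (lam i) * mvar i * a"
  obtains H G b where "transformation n H" "\<forall>i\<in>{1..n}. weight_part n lam (lam i) (H i - mvar i) = 0"
    "transforms_to n H F G" "\<forall>i\<in>{1..n}. homog n lam (lam i) (G i)"
    "order_ge 1 b" "\<forall>i\<in>{1..l}. G i = mconst (lam i) * (mvar i * (1 + b))"
proof -
  define h0 where "h0 i = H0 i - mvar i" for i
  have h0: "order_ge 2 (h0 i)" "in_vars {1..n} (h0 i)" if "i \<in> {1..n}" for i
    using H0(1) that by (auto simp: transformation_def h0_def intro!: in_vars_diff in_vars_mvar)
  have H0': "\<forall>i\<in>{1..n}. in_vars {1..n} (H0 i)" "\<forall>i\<in>{1..n}. order_ge 1 (H0 i)"
  proof -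
    have "order_ge 1 (h0 i + mvar i)" if "i \<in> {1..n}" for i
      using order_ge_mono[OF h0(1)[OF that], of 1] by (intro order_ge_add) auto
    then show "\<forall>i\<in>{1..n}. order_ge 1 (H0 i)" by (simp add: h0_def)
  qed (use H0(1) in \<open>auto simp: transformation_def\<close>)

  define \<Phi> where "\<Phi> k i = (if i \<in> {1..n} then - weight_part n lam (lam i) (msubst n (h0 i) (\<lambda>i. mvar i + k i)) else 0)"
    for k :: "nat \<Rightarrow> complex mfps" and i
  have "\<exists>k. \<Phi> k = k \<and> (\<forall>i K. mcoeff (k i) K \<noteq> 0 \<longrightarrow>
      i \<in> {1..n} \<and> 2 \<le> tdeg K \<and> Poly_Mapping.keys K \<subseteq> {1..n} \<and> wt n lam K = lam i)"
  proof (rule formal_fixed_point[of "\<lambda>i K. i \<in> {1..n} \<and> 2 \<le> tdeg K \<and> Poly_Mapping.keys K \<subseteq> {1..n} \<and> wt n lam K = lam i" \<Phi>])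
    let ?adm = "\<lambda>f. \<forall>i K. mcoeff (f i) K \<noteq> (0::complex) \<longrightarrow> i \<in> {1..n} \<and> 2 \<le> tdeg K \<and> Poly_Mapping.keys K \<subseteq> {1..n} \<and> wt n lam K = lam i"
    have o: "order_ge 1 (mvar i + f i)" if "?adm f" for f :: "nat \<Rightarrow> complex mfps" and i
    proof (rule order_ge_add)
      show "order_ge 1 (f i)"
        unfolding order_ge_def
      proof (intro allI impI, rule ccontr)
        fix K assume "tdeg K < 1" "mcoeff (f i) K \<noteq> 0"
        moreover from this that have "2 \<le> tdeg K" by blast
        ultimately show False by simp
      qed
    qed simp
    show "order_ge (Suc d) (\<Phi> f i - \<Phi> g i)"
      if "?adm f" "?adm g" "\<And>i. order_ge d (f i - g i)" for f g d i
    proof (cases "i \<in> {1..n}")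
      case True
      have "order_ge (Suc d) (msubst n (h0 i) (\<lambda>i. mvar i + g i) - msubst n (h0 i) (\<lambda>i. mvar i + f i))"
        using that(3) h0(1)[OF True] o[OF that(1)] o[OF that(2)]
        by (intro order_ge_msubst_diff) (auto simp: order_ge_def)
      from order_ge_weight_part[OF this, of n lam "lam i"] show ?thesis
        using True by (simp add: \<Phi>_def weight_part_arith)
    next
      case False
      then show ?thesis unfolding \<Phi>_def if_not_P[OF False] by simp
    qed
    show "?adm (\<Phi> f)" if f: "?adm f" for f
    proof (intro allI impI)
      fix i K assume ne: "mcoeff (\<Phi> f i) K \<noteq> 0"
      then have i: "i \<in> {1..n}" by (auto simp: \<Phi>_def split: if_splits)
      have "in_vars {1..n} (mvar j + f j)" if "j \<in> {1..n}" for j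
        using f that by (intro in_vars_add in_vars_mvar) (auto simp: in_vars_def)
      then have "in_vars {1..n} (msubst n (h0 i) (\<lambda>i. mvar i + f i))"
        by (intro in_vars_msubst) auto
      then have "homog n lam (lam i) (\<Phi> f i)"
        using i by (simp add: \<Phi>_def homog_weight_part homog_uminus)
      moreover have "order_ge 2 (\<Phi> f i)"
        using i h0(1) by (auto simp: \<Phi>_def intro!: order_ge_uminus order_ge_weight_part order_ge_msubst)
      ultimately show "i \<in> {1..n} \<and> 2 \<le> tdeg K \<and> Poly_Mapping.keys K \<subseteq> {1..n} \<and> wt n lam K = lam i"
        using ne i unfolding homog_def order_ge_def by (meson not_less)
    qed
  qed
  then obtain k where k: "\<Phi> k = k"
    "\<forall>i K. mcoeff (k i) K \<noteq> 0 \<longrightarrow> i \<in> {1..n} \<and> 2 \<le> tdeg K \<and> Poly_Mapping.keys K \<subseteq> {1..n} \<and> wt n lam K = lam i"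
    by (elim exE conjE)
  have k_hom: "homog n lam (lam i) (k i)" for i using k(2) by (auto simp: homog_def)
  have k_ord: "order_ge 2 (k i)" for i
    unfolding order_ge_def using k(2) by (metis not_less)
  define K where "K i = mvar i + k i" for i
  have K_hom: "\<forall>i\<in>{1..n}. homog n lam (lam i) (K i)"
    using k_hom by (auto simp: K_def intro!: homog_add homog_mvar)
  then have K_iv: "\<forall>i\<in>{1..n}. in_vars {1..n} (K i)" by (auto intro: homog_imp_in_vars)
  have K_ord: "\<forall>i\<in>{1..n}. order_ge 1 (K i)"
    using order_ge_mono[OF k_ord, of 1] by (auto simp: K_def intro!: order_ge_add)

  define H where "H i = msubst n (H0 i) K" for i
  have H_eq: "H i - mvar i = k i + msubst n (h0 i) K" if "i \<in> {1..n}" for i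
  proof -
    have "msubst n (h0 i) K = H i - K i"
      using that by (simp add: h0_def msubst_arith msubst_mvar[OF K_ord] H_def)
    then show ?thesis by (simp add: K_def)
  qed
  have H_iv: "\<forall>i\<in>{1..n}. in_vars {1..n} (H i)"
    unfolding H_def using in_vars_msubst[OF K_iv] by blast
  have H_trans: "transformation n H"
    unfolding transformation_def using H_iv h0(1) k_ord
    by (auto simp: H_eq intro!: order_ge_add order_ge_msubst)
  have H_dist: "\<forall>i\<in>{1..n}. weight_part n lam (lam i) (H i - mvar i) = 0"
  proof
    fix i assume i: "i \<in> {1..n}"
    have "k i = \<Phi> k i" by (simp add: k(1))
    also have "\<dots> = - weight_part n lam (lam i) (msubst n (h0 i) K)"
      using i by (simp add: \<Phi>_def K_def[abs_def])
    finally have "k i + weight_part n lam (lam i) (msubst n (h0 i) K) = 0"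
      by (simp add: eq_neg_iff_add_eq_0)
    then show "weight_part n lam (lam i) (H i - mvar i) = 0"
      using i by (simp add: H_eq weight_part_arith weight_part_homog[OF k_hom])
  qed

  define \<Psi> where "\<Psi> G i = (if i \<in> {1..n} then msubst n (G0 i) K - (\<Sum>j=1..n. mderiv j (k i) * G j) else 0)"
    for G :: "nat \<Rightarrow> complex mfps" and i
  have dk_ord: "order_ge 1 (mderiv j (k i))" for i j
    using k_ord[of i] by (intro order_ge_mderiv) (simp add: numeral_2_eq_2 One_nat_def)
  have "\<exists>G. \<Psi> G = G \<and> (\<forall>i K. mcoeff (G i) K \<noteq> 0 \<longrightarrow>
      i \<in> {1..n} \<and> Poly_Mapping.keys K \<subseteq> {1..n} \<and> wt n lam K = lam i)"
  proof (rule formal_fixed_point[of "\<lambda>i K. i \<in> {1..n} \<and> Poly_Mapping.keys K \<subseteq> {1..n} \<and> wt n lam K = lam i" \<Psi>])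
    let ?adm = "\<lambda>f. \<forall>i K. mcoeff (f i) K \<noteq> (0::complex) \<longrightarrow> i \<in> {1..n} \<and> Poly_Mapping.keys K \<subseteq> {1..n} \<and> wt n lam K = lam i"
    show "order_ge (Suc d) (\<Psi> f i - \<Psi> g i)"
      if "\<And>i. order_ge d (f i - g i)" for f g :: "nat \<Rightarrow> complex mfps" and d i
    proof (cases "i \<in> {1..n}")
      case True
      have "order_ge (1 + d) (mderiv j (k i) * (g j - f j))" for j
        using order_ge_uminus[OF that[of j]] by (intro order_ge_mult dk_ord) simp
      then have "order_ge (1 + d) (\<Sum>j=1..n. mderiv j (k i) * (g j - f j))"
        by (intro order_ge_sum) simp
      then show ?thesis
        using True by (simp add: \<Psi>_def right_diff_distrib sum_subtractf plus_1_eq_Suc)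
    next
      case False
      then show ?thesis unfolding \<Psi>_def if_not_P[OF False] by simp
    qed
    show "?adm (\<Psi> f)" if f: "?adm f" for f
    proof (intro allI impI)
      fix i L assume ne: "mcoeff (\<Psi> f i) L \<noteq> 0"
      then have i: "i \<in> {1..n}" by (auto simp: \<Psi>_def split: if_splits)
      have "homog n lam (lam i - lam j + lam j) (mderiv j (k i) * f j)" if "j \<in> {1..n}" for j
        using f that by (intro homog_mult homog_mderiv k_hom) (auto simp: homog_def)
      then have "homog n lam (lam i) (\<Psi> f i)"
        unfolding \<Psi>_def using i G0 K_hom by (auto intro!: homog_diff homog_msubst homog_sum)
      then show "i \<in> {1..n} \<and> Poly_Mapping.keys L \<subseteq> {1..n} \<and> wt n lam L = lam i"
        using ne i by (simp add: homog_def)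
    qed
  qed
  then obtain G where G: "\<Psi> G = G"
    "\<forall>i K. mcoeff (G i) K \<noteq> 0 \<longrightarrow> i \<in> {1..n} \<and> Poly_Mapping.keys K \<subseteq> {1..n} \<and> wt n lam K = lam i"
    by (elim exE conjE)
  have G_hom: "\<forall>i\<in>{1..n}. homog n lam (lam i) (G i)" using G(2) by (auto simp: homog_def)
  have G_eq: "G i = msubst n (G0 i) K - (\<Sum>j=1..n. mderiv j (k i) * G j)" if "i \<in> {1..n}" for i
    using fun_cong[OF G(1), of i] that by (simp add: \<Psi>_def)
  have KG: "(\<Sum>j=1..n. mderiv j (K i) * G j) = msubst n (G0 i) K" if "i \<in> {1..n}" for i
  proof -
    have "(\<Sum>j=1..n. mderiv j (K i) * G j) = (\<Sum>j=1..n. (if i = j then G j else 0)) + (\<Sum>j=1..n. mderiv j (k i) * G j)"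
      unfolding sum.distrib[symmetric] by (intro sum.cong) (auto simp: K_def distrib_right)
    then show ?thesis using G_eq[OF that] that by (simp add: sum.delta')
  qed
  have H_G: "transforms_to n H F G"
    unfolding transforms_to_def formal_field_def
  proof (intro conjI ballI)
    fix i assume i: "i \<in> {1..n}"
    show "in_vars {1..n} (G i)" using G_hom i by (auto intro: homog_imp_in_vars)
    have iv: "in_vars {1..n} (mderiv j (H0 i))" "j \<in> {1..n} \<Longrightarrow> in_vars {1..n} (G0 j)" for j
      using H0'(1) G0 i by (auto intro: in_vars_mderiv homog_imp_in_vars)
    have "(\<Sum>m=1..n. mderiv m (H i) * G m) =
        (\<Sum>m=1..n. \<Sum>j=1..n. msubst n (mderiv j (H0 i)) K * mderiv m (K j) * G m)"
      unfolding H_def using H0'(1) i by (simp add: mderiv_msubst[OF K_ord] sum_distrib_right)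
    also have "\<dots> = (\<Sum>j=1..n. msubst n (mderiv j (H0 i)) K * (\<Sum>m=1..n. mderiv m (K j) * G m))"
      by (subst sum.swap) (simp add: sum_distrib_left mult.assoc)
    also have "\<dots> = (\<Sum>j=1..n. msubst n (mderiv j (H0 i) * G0 j) K)"
      using iv by (intro sum.cong) (auto simp: KG msubst_mult[OF K_ord])
    also have "\<dots> = msubst n (\<Sum>j=1..n. mderiv j (H0 i) * G0 j) K"
      by (simp add: msubst_sum)
    also have "\<dots> = msubst n (msubst n (F i) H0) K"
      using H0(2) i by (simp add: transforms_to_def)
    also have "\<dots> = msubst n (F i) (\<lambda>i. msubst n (H0 i) K)"
      using F i by (intro msubst_assoc H0' K_ord) auto
    finally show "(\<Sum>m=1..n. mderiv m (H i) * G m) = msubst n (F i) H"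
      by (simp add: H_def[abs_def])
  qed

  \<comment> \<open>The deviation $\<delta>$ of $G'$ from $(\<lambda>' \odot y')\,(a \circ K)$ satisfies a homogeneous contractive equation, so it vanishes.\<close>
  define \<alpha> where "\<alpha> = msubst n a K"
  have "order_ge 1 (msubst n (a - 1) K)"
    using a(2) by (intro order_ge_msubst) (auto simp: order_ge_def)
  then have b: "order_ge 1 (\<alpha> - 1)"
    by (simp add: msubst_arith msubst_1[OF K_ord] \<alpha>_def)
  define \<delta> where "\<delta> i = G i - mconst (lam i) * mvar i * \<alpha>" for i
  have \<delta>: "\<delta> i = - (\<Sum>j=1..l. mderiv j (k i) * \<delta> j)" if i: "i \<in> {1..l}" for i
  proof -
    have i': "i \<in> {1..n}" using i l by simp
    have "msubst n (G0 i) K = mconst (lam i) * K i * \<alpha>"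
      using G0a i i' a(1) by (simp add: mult.assoc msubst_arith msubst_mult[OF K_ord] in_vars_mvar
          msubst_mvar[OF K_ord] \<alpha>_def)
    then have "\<delta> i = (mconst (lam i) * k i) * \<alpha> - (\<Sum>j=1..n. mderiv j (k i) * G j)"
      unfolding \<delta>_def by (subst G_eq[OF i']) (simp add: K_def algebra_simps)
    also have "\<dots> = - (\<Sum>j=1..n. mderiv j (k i) * \<delta> j)"
      unfolding euler_identity[OF k_hom, symmetric]
      by (simp add: \<delta>_def right_diff_distrib sum_subtractf sum_distrib_left sum_distrib_right mult_ac)
    also have "(\<Sum>j=1..n. mderiv j (k i) * \<delta> j) = (\<Sum>j=1..l. mderiv j (k i) * \<delta> j)"
    proof (rule sum.mono_neutral_right)
      show "\<forall>j\<in>{1..n} - {1..l}. mderiv j (k i) * \<delta> j = 0"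
        using mderiv_eq_0_if_weight_imaginary[of l lam n "lam i" "k i", OF re0 pos k_hom re0[OF i]] by auto
    qed (use l in auto)
    finally show ?thesis .
  qed
  have "order_ge d (\<delta> i)" if "i \<in> {1..l}" for i d
    using that
  proof (induction d arbitrary: i)
    case (Suc d)
    have "order_ge (1 + d) (- (\<Sum>j=1..l. mderiv j (k i) * \<delta> j))"
      using Suc.IH by (intro order_ge_uminus order_ge_sum order_ge_mult dk_ord) auto
    then show ?case using \<delta>[OF Suc.prems] by (simp add: plus_1_eq_Suc)
  qed simp
  then have "\<delta> i = 0" if "i \<in> {1..l}" for i
    using that by (intro mfps_eqI_order) simp
  then have "\<forall>i\<in>{1..l}. G i = mconst (lam i) * (mvar i * (1 + (\<alpha> - 1)))"
    by (simp add: \<delta>_def mult.assoc)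
  then show ?thesis
    by (rule that[OF H_trans H_dist H_G G_hom b])
qed

section \<open>Weighted norms of truncated series\<close>

text \<open>
  The value of the monomial $x^K$ at the polyradius $\<rho>$.
\<close>

definition mon :: "nat \<Rightarrow> (nat \<Rightarrow> real) \<Rightarrow> (nat \<Rightarrow>\<^sub>0 nat) \<Rightarrow> real" where
  "mon n \<rho> K = (\<Prod>i=1..n. \<rho> i ^ Poly_Mapping.lookup K i)"

lemma mon_0 [simp]: "mon n \<rho> 0 = 1"
  by (simp add: mon_def)

lemma mon_add: "mon n \<rho> (P + Q) = mon n \<rho> P * mon n \<rho> Q"
  by (simp add: mon_def lookup_add power_add prod.distrib)

lemma mon_single [simp]: "i \<in> {1..n} \<Longrightarrow> mon n \<rho> (Poly_Mapping.single i 1) = \<rho> i"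
  by (simp add: mon_def lookup_single when_def if_distrib[of "\<lambda>k. _ ^ k"] prod.delta cong: if_cong)

lemma mon_nonneg: "\<forall>i\<in>{1..n}. 0 \<le> \<rho> i \<Longrightarrow> 0 \<le> mon n \<rho> K"
  unfolding mon_def by (intro prod_nonneg) auto

lemma mon_mono: "\<forall>i\<in>{1..n}. 0 \<le> \<rho> i \<and> \<rho> i \<le> \<rho>' i \<Longrightarrow> mon n \<rho> K \<le> mon n \<rho>' K"
  unfolding mon_def by (intro prod_mono) (auto intro: power_mono)

lemma mon_const: "Poly_Mapping.keys K \<subseteq> {1..n} \<Longrightarrow> mon n (\<lambda>_. c) K = c ^ tdeg K"
  by (simp add: mon_def tdeg_eq_sum[of "{1..n}"] power_sum)

text \<open>
  The norm $\sum |f_K| \<rho>^K$ of the truncation at degree $D$. Convergence of a series amounts to a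
  bound that is uniform in $D$, and truncating allows such a bound to be proved by induction on $D$.
\<close>

definition pnorm :: "nat \<Rightarrow> (nat \<Rightarrow> real) \<Rightarrow> nat \<Rightarrow> complex mfps \<Rightarrow> real" where
  "pnorm n \<rho> D f = (\<Sum>K\<in>exps n D. cmod (mcoeff f K) * mon n \<rho> K)"

locale polyradius =
  fixes n :: nat and \<rho> :: "nat \<Rightarrow> real"
  assumes radius_nonneg: "\<forall>i\<in>{1..n}. 0 \<le> \<rho> i"
begin

lemma pnorm_nonneg: "0 \<le> pnorm n \<rho> D f"
  unfolding pnorm_def using mon_nonneg[OF radius_nonneg] by (intro sum_nonneg) simp

lemma pnorm_0 [simp]: "pnorm n \<rho> D 0 = 0"
  by (simp add: pnorm_def)

lemma pnorm_le:
  assumes "\<And>K. K \<in> exps n D \<Longrightarrow> cmod (mcoeff f K) \<le> c * cmod (mcoeff g K)"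
  shows "pnorm n \<rho> D f \<le> c * pnorm n \<rho> D g"
  unfolding pnorm_def sum_distrib_left mult.assoc[symmetric]
  using assms mon_nonneg[OF radius_nonneg] by (intro sum_mono mult_right_mono) auto

lemma pnorm_add: "pnorm n \<rho> D (f + g) \<le> pnorm n \<rho> D f + pnorm n \<rho> D g"
  unfolding pnorm_def sum.distrib[symmetric] distrib_right[symmetric]
  using mon_nonneg[OF radius_nonneg] by (intro sum_mono mult_right_mono) (auto simp: norm_triangle_ineq)

lemma pnorm_uminus [simp]: "pnorm n \<rho> D (- f) = pnorm n \<rho> D f"
  by (simp add: pnorm_def)

lemma pnorm_diff: "pnorm n \<rho> D (f - g) \<le> pnorm n \<rho> D f + pnorm n \<rho> D g"
  using pnorm_add[of D f "- g"] by simp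

lemma pnorm_sum: "pnorm n \<rho> D (\<Sum>a\<in>A. f a) \<le> (\<Sum>a\<in>A. pnorm n \<rho> D (f a))"
proof (induction A rule: infinite_finite_induct)
  case (insert a A)
  then show ?case using pnorm_add[of D "f a" "\<Sum>a\<in>A. f a"] by simp
qed simp_all

lemma pnorm_mconst_mult: "pnorm n \<rho> D (mconst c * f) = cmod c * pnorm n \<rho> D f"
  by (simp add: pnorm_def sum_distrib_left norm_mult mult.assoc)

lemma pnorm_1_le: "pnorm n \<rho> D 1 \<le> 1"
proof -
  have "pnorm n \<rho> D 1 = (\<Sum>K\<in>exps n D. if K = 0 then 1 else 0)"
    unfolding pnorm_def by (intro sum.cong) auto
  then show ?thesis by simp
qed

lemma pnorm_mvar_le:
  assumes "i \<in> {1..n}"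
  shows "pnorm n \<rho> D (mvar i) \<le> \<rho> i"
proof -
  have "pnorm n \<rho> D (mvar i) = (\<Sum>K\<in>exps n D. if K = Poly_Mapping.single i 1 then \<rho> i else 0)"
    unfolding pnorm_def using assms by (intro sum.cong) (auto simp: mcoeff_mvar)
  then show ?thesis using assms radius_nonneg by simp
qed

text \<open>
  In a product of total degree at most $D$, a factor $f$ of order $d$ leaves only degree $D - d$ for $g$,
  and conversely.
\<close>

lemma pnorm_mult:
  assumes f: "order_ge d f" and g: "order_ge e g"
  shows "pnorm n \<rho> D (f * g) \<le> pnorm n \<rho> (D - e) f * pnorm n \<rho> (D - d) g"
proof -
  let ?t = "\<lambda>(P, Q). (cmod (mcoeff f P) * mon n \<rho> P) * (cmod (mcoeff g Q) * mon n \<rho> Q)"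
  have t_nonneg: "0 \<le> ?t PQ" for PQ
    using mon_nonneg[OF radius_nonneg] by (auto split: prod.split)
  have "pnorm n \<rho> D (f * g) \<le> (\<Sum>K\<in>exps n D. \<Sum>PQ\<in>splits K. ?t PQ)"
    unfolding pnorm_def
  proof (rule sum_mono)
    fix K
    have "cmod (mcoeff (f * g) K) \<le> (\<Sum>PQ\<in>splits K. cmod (case PQ of (P, Q) \<Rightarrow> mcoeff f P * mcoeff g Q))"
      unfolding mcoeff_mult by (rule norm_sum)
    then have "cmod (mcoeff (f * g) K) * mon n \<rho> K \<le>
        (\<Sum>PQ\<in>splits K. cmod (case PQ of (P, Q) \<Rightarrow> mcoeff f P * mcoeff g Q)) * mon n \<rho> K"
      using mon_nonneg[OF radius_nonneg] by (rule mult_right_mono)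
    also have "\<dots> = (\<Sum>PQ\<in>splits K. ?t PQ)"
      unfolding sum_distrib_right by (intro sum.cong) (auto simp: splits_def mon_add norm_mult)
    finally show "cmod (mcoeff (f * g) K) * mon n \<rho> K \<le> (\<Sum>PQ\<in>splits K. ?t PQ)" .
  qed
  also have "\<dots> = (\<Sum>(K, PQ)\<in>(SIGMA K:exps n D. splits K). ?t PQ)"
    by (rule sum.Sigma) auto
  also have "\<dots> = (\<Sum>(K, PQ)\<in>(SIGMA K:exps n D. {(P, Q)\<in>splits K. d \<le> tdeg P \<and> e \<le> tdeg Q}). ?t PQ)"
  proof (rule sum.mono_neutral_right)
    show "finite (SIGMA K:exps n D. splits K)" by simp
    show "\<forall>x\<in>(SIGMA K:exps n D. splits K) -
        (SIGMA K:exps n D. {(P, Q)\<in>splits K. d \<le> tdeg P \<and> e \<le> tdeg Q}). (case x of (K, PQ) \<Rightarrow> ?t PQ) = 0"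
      using f g unfolding order_ge_def by (auto simp: not_le[symmetric])
  qed auto
  also have "\<dots> = (\<Sum>PQ\<in>snd ` (SIGMA K:exps n D. {(P, Q)\<in>splits K. d \<le> tdeg P \<and> e \<le> tdeg Q}). ?t PQ)"
    by (subst sum.reindex) (auto simp: inj_on_def splits_def case_prod_unfold)
  also have "\<dots> \<le> (\<Sum>PQ\<in>exps n (D - e) \<times> exps n (D - d). ?t PQ)"
  proof (rule sum_mono2)
    show "snd ` (SIGMA K:exps n D. {(P, Q)\<in>splits K. d \<le> tdeg P \<and> e \<le> tdeg Q})
        \<subseteq> exps n (D - e) \<times> exps n (D - d)"
      by (auto simp: exps_def splits_def keys_add_nat)
  qed (use t_nonneg in auto)
  also have "\<dots> = pnorm n \<rho> (D - e) f * pnorm n \<rho> (D - d) g"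
    unfolding pnorm_def sum_product sum.cartesian_product by (simp add: case_prod_unfold)
  finally show ?thesis .
qed

lemma pnorm_mvar_mult_ge:
  assumes i: "i \<in> {1..n}"
  shows "\<rho> i * pnorm n \<rho> D f \<le> pnorm n \<rho> (Suc D) (mvar i * f)"
proof -
  let ?e = "Poly_Mapping.single i 1 :: nat \<Rightarrow>\<^sub>0 nat"
  have "\<rho> i * pnorm n \<rho> D f = (\<Sum>K\<in>exps n D. cmod (mcoeff (mvar i * f) (K + ?e)) * mon n \<rho> (K + ?e))"
    unfolding pnorm_def sum_distrib_left using i by (intro sum.cong) (auto simp: mon_add)
  also have "\<dots> = (\<Sum>K\<in>(\<lambda>K. K + ?e) ` exps n D. cmod (mcoeff (mvar i * f) K) * mon n \<rho> K)"
    by (subst sum.reindex) (auto simp: inj_on_def)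
  also have "\<dots> \<le> pnorm n \<rho> (Suc D) (mvar i * f)"
    unfolding pnorm_def using i mon_nonneg[OF radius_nonneg]
    by (intro sum_mono2) (simp, auto simp: exps_def keys_add_nat)
  finally show ?thesis .
qed

lemma pnorm_mprod:
  assumes "Poly_Mapping.keys Q \<subseteq> {1..n}"
  shows "pnorm n \<rho> D (mprod n H Q) \<le> mon n (\<lambda>i. pnorm n \<rho> D (H i)) Q"
  using assms
proof (induction rule: exponent_induct)
  case zero
  then show ?case by (simp add: pnorm_1_le)
next
  case (add L i)
  have "pnorm n \<rho> D (mprod n H L * H i) \<le> pnorm n \<rho> D (mprod n H L) * pnorm n \<rho> D (H i)"
    using pnorm_mult[of 0 _ 0 _ D] by simp
  also have "\<dots> \<le> mon n (\<lambda>i. pnorm n \<rho> D (H i)) L * pnorm n \<rho> D (H i)"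
    using add.IH pnorm_nonneg by (intro mult_right_mono)
  finally show ?case
    using add.hyps by (simp add: mprod_add mon_add)
qed

text \<open>
  With at least two factors of order one, no factor can contribute a term of the top degree $D + 1$.
\<close>

lemma pnorm_mprod_shift:
  assumes H: "\<forall>i\<in>{1..n}. order_ge 1 (H i)" and Q: "Poly_Mapping.keys Q \<subseteq> {1..n}" "2 \<le> tdeg Q"
  shows "pnorm n \<rho> (Suc D) (mprod n H Q) \<le> mon n (\<lambda>i. pnorm n \<rho> D (H i)) Q"
proof -
  have "Q \<noteq> 0" using Q(2) by auto
  then obtain i where i: "i \<in> Poly_Mapping.keys Q"
    by (metis keys_eq_empty equals0I)
  then obtain L where L: "Q = L + Poly_Mapping.single i 1"
    using exponent_decrease[of Q i] by (metis in_keys_iff)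
  have i': "i \<in> {1..n}" and L': "Poly_Mapping.keys L \<subseteq> {1..n}" "1 \<le> tdeg L"
    using i Q by (auto simp: L keys_add_nat)
  have "order_ge 1 (mprod n H L)"
    using order_ge_mprod[OF H L'(1)] L'(2) by (rule order_ge_mono)
  then have "pnorm n \<rho> (Suc D) (mprod n H L * H i) \<le> pnorm n \<rho> D (mprod n H L) * pnorm n \<rho> D (H i)"
    using pnorm_mult[of 1 "mprod n H L" 1 "H i" "Suc D"] H i' by (simp add: One_nat_def)
  also have "\<dots> \<le> mon n (\<lambda>i. pnorm n \<rho> D (H i)) L * pnorm n \<rho> D (H i)"
    using pnorm_mprod[OF L'(1)] pnorm_nonneg by (intro mult_right_mono)
  finally show ?thesis
    using i' by (simp add: L mprod_add mon_add)
qed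

lemma pnorm_msubst:
  assumes H: "\<forall>i\<in>{1..n}. order_ge 1 (H i)" and f: "order_ge 2 f"
  shows "pnorm n \<rho> (Suc D) (msubst n f H) \<le>
    (\<Sum>Q\<in>exps n (Suc D). cmod (mcoeff f Q) * mon n (\<lambda>i. pnorm n \<rho> D (H i)) Q)"
proof -
  have coeff: "mcoeff (msubst n f H) K = mcoeff (\<Sum>Q\<in>exps n (Suc D). mconst (mcoeff f Q) * mprod n H Q) K"
    if K: "K \<in> exps n (Suc D)" for K
  proof -
    have "(\<Sum>Q\<in>exps n (Suc D). mcoeff f Q * mcoeff (mprod n H Q) K) =
        (\<Sum>Q\<in>exps n (tdeg K). mcoeff f Q * mcoeff (mprod n H Q) K)"
    proof (rule sum.mono_neutral_right)
      show "exps n (tdeg K) \<subseteq> exps n (Suc D)" using K by (intro exps_mono) (simp add: exps_def)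
      show "\<forall>Q\<in>exps n (Suc D) - exps n (tdeg K). mcoeff f Q * mcoeff (mprod n H Q) K = 0"
        using order_ge_mprod[OF H] unfolding order_ge_def by (auto simp: exps_def) (meson not_le)
    qed simp
    then show ?thesis by (simp add: mcoeff_msubst)
  qed
  have "pnorm n \<rho> (Suc D) (msubst n f H) =
      pnorm n \<rho> (Suc D) (\<Sum>Q\<in>exps n (Suc D). mconst (mcoeff f Q) * mprod n H Q)"
    unfolding pnorm_def using coeff by (intro sum.cong) simp_all
  also have "\<dots> \<le> (\<Sum>Q\<in>exps n (Suc D). cmod (mcoeff f Q) * pnorm n \<rho> (Suc D) (mprod n H Q))"
    using pnorm_sum[of "Suc D" "\<lambda>Q. mconst (mcoeff f Q) * mprod n H Q"] by (simp add: pnorm_mconst_mult)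
  also have "\<dots> \<le> (\<Sum>Q\<in>exps n (Suc D). cmod (mcoeff f Q) * mon n (\<lambda>i. pnorm n \<rho> D (H i)) Q)"
  proof (rule sum_mono)
    fix Q assume Q: "Q \<in> exps n (Suc D)"
    show "cmod (mcoeff f Q) * pnorm n \<rho> (Suc D) (mprod n H Q) \<le>
        cmod (mcoeff f Q) * mon n (\<lambda>i. pnorm n \<rho> D (H i)) Q"
    proof (cases "2 \<le> tdeg Q")
      case True
      then show ?thesis
        using Q pnorm_mprod_shift[OF H] by (intro mult_left_mono) (auto simp: exps_def)
    next
      case False
      then show ?thesis using f by (simp add: order_ge_def)
    qed
  qed
  finally show ?thesis .
qed

text \<open>
  Shrinking the polyradius by the factor $s$ gains $s^2$, since $f$ has no terms of degree less than two.
\<close>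

lemma pnorm_msubst_le:
  assumes H: "\<forall>i\<in>{1..n}. order_ge 1 (H i)" and f: "order_ge 2 f"
    and s: "0 \<le> s" "s \<le> 1" and small: "\<forall>i\<in>{1..n}. pnorm n \<rho> D (H i) \<le> s * R"
    and M: "\<And>D. pnorm n (\<lambda>_. R) D f \<le> M" and R: "0 \<le> R"
  shows "pnorm n \<rho> (Suc D) (msubst n f H) \<le> s\<^sup>2 * M"
proof -
  have "pnorm n \<rho> (Suc D) (msubst n f H) \<le>
      (\<Sum>Q\<in>exps n (Suc D). cmod (mcoeff f Q) * mon n (\<lambda>i. pnorm n \<rho> D (H i)) Q)"
    by (rule pnorm_msubst[OF H f])
  also have "\<dots> \<le> (\<Sum>Q\<in>exps n (Suc D). s\<^sup>2 * (cmod (mcoeff f Q) * mon n (\<lambda>_. R) Q))"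
  proof (rule sum_mono)
    fix Q assume Q: "Q \<in> exps n (Suc D)"
    show "cmod (mcoeff f Q) * mon n (\<lambda>i. pnorm n \<rho> D (H i)) Q \<le> s\<^sup>2 * (cmod (mcoeff f Q) * mon n (\<lambda>_. R) Q)"
    proof (cases "2 \<le> tdeg Q")
      case True
      have k: "Poly_Mapping.keys Q \<subseteq> {1..n}" using Q by (simp add: exps_def)
      have "mon n (\<lambda>i. pnorm n \<rho> D (H i)) Q \<le> mon n (\<lambda>_. s * R) Q"
        using small pnorm_nonneg by (intro mon_mono) simp
      also have "\<dots> = s ^ tdeg Q * mon n (\<lambda>_. R) Q"
        using k by (simp add: mon_const power_mult_distrib)
      also have "\<dots> \<le> s\<^sup>2 * mon n (\<lambda>_. R) Q"
        using s True R by (intro mult_right_mono power_decreasing mon_nonneg) auto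
      finally have "cmod (mcoeff f Q) * mon n (\<lambda>i. pnorm n \<rho> D (H i)) Q \<le>
          cmod (mcoeff f Q) * (s\<^sup>2 * mon n (\<lambda>_. R) Q)"
        by (rule mult_left_mono) simp
      then show ?thesis by (simp add: mult.left_commute)
    next
      case False
      then show ?thesis using f by (simp add: order_ge_def)
    qed
  qed
  also have "\<dots> = s\<^sup>2 * pnorm n (\<lambda>_. R) (Suc D) f"
    by (simp add: pnorm_def sum_distrib_left)
  also have "\<dots> \<le> s\<^sup>2 * M"
    using M by (intro mult_left_mono) auto
  finally show ?thesis .
qed

end

lemma convergent_imp_pnorm_bounded:
  assumes "convergent_mfps n f"
  obtains R M where "0 < R" "\<And>D. pnorm n (\<lambda>_. R) D f \<le> M"
proof -
  obtain r where r: "r > 0" and sum: "\<And>x :: nat \<Rightarrow> complex. (\<forall>i\<in>{1..n}. cmod (x i) < r) \<Longrightarrow>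
     (\<lambda>Q. mcoeff f Q * (\<Prod>i=1..n. x i ^ Poly_Mapping.lookup Q i)) summable_on {Q. Poly_Mapping.keys Q \<subseteq> {1..n}}"
    using assms unfolding convergent_mfps_def by blast
  define R where "R = r / 2"
  define A where "A = {Q :: nat \<Rightarrow>\<^sub>0 nat. Poly_Mapping.keys Q \<subseteq> {1..n}}"
  let ?g = "\<lambda>Q. cmod (mcoeff f Q) * mon n (\<lambda>_. R) Q"
  have "(\<lambda>Q. mcoeff f Q * (\<Prod>i=1..n. complex_of_real R ^ Poly_Mapping.lookup Q i)) summable_on A"
    unfolding A_def using r by (intro sum) (simp add: R_def)
  then have "(\<lambda>Q. norm (mcoeff f Q * (\<Prod>i=1..n. complex_of_real R ^ Poly_Mapping.lookup Q i))) summable_on A"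
    by (simp add: summable_on_iff_abs_summable_on_complex)
  then have s: "?g summable_on A"
    using r by (simp add: norm_mult mon_def R_def norm_power flip: prod_norm)
  show ?thesis
  proof (rule that)
    show "0 < R" using r by (simp add: R_def)
    show "pnorm n (\<lambda>_. R) D f \<le> infsum ?g A" for D
      unfolding pnorm_def using r
      by (intro finite_sum_le_infsum[OF s])
        (simp, auto simp: exps_def A_def R_def intro!: mult_nonneg_nonneg mon_nonneg)
  qed
qed

lemma pnorm_bounded_imp_convergent:
  assumes r: "0 < r" and \<rho>: "\<forall>i\<in>{1..n}. r \<le> \<rho> i" and M: "\<And>D. pnorm n \<rho> D f \<le> M"
  shows "convergent_mfps n f"
  unfolding convergent_mfps_def
proof (intro exI[of _ r] conjI allI impI r)
  fix x :: "nat \<Rightarrow> complex" assume x: "\<forall>i\<in>{1..n}. cmod (x i) < r"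
  let ?A = "{Q :: nat \<Rightarrow>\<^sub>0 nat. Poly_Mapping.keys Q \<subseteq> {1..n}}"
  let ?t = "\<lambda>Q. mcoeff f Q * (\<Prod>i=1..n. x i ^ Poly_Mapping.lookup Q i)"
  have \<rho>0: "\<forall>i\<in>{1..n}. 0 \<le> \<rho> i" using r \<rho> by (meson less_imp_le order_trans)
  have "(\<lambda>Q. norm (?t Q)) summable_on ?A"
  proof (rule nonneg_bdd_above_summable_on)
    show "bdd_above (sum (\<lambda>Q. norm (?t Q)) ` {F. F \<subseteq> ?A \<and> finite F})"
    proof (rule bdd_aboveI2)
      fix F assume F: "F \<in> {F. F \<subseteq> ?A \<and> finite F}"
      have "F \<subseteq> exps n (Max (tdeg ` F))"
        using F by (auto simp: exps_def intro!: Max_ge)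
      moreover have "norm (?t Q) \<le> cmod (mcoeff f Q) * mon n \<rho> Q" for Q
      proof -
        have "cmod (x i) \<le> \<rho> i" if "i \<in> {1..n}" for i
          using x \<rho> that by (meson less_imp_le order_trans)
        then show ?thesis
          unfolding norm_mult mon_def prod_norm[symmetric] norm_power
          by (intro mult_left_mono prod_mono conjI power_mono) auto
      qed
      ultimately have "sum (\<lambda>Q. norm (?t Q)) F \<le> pnorm n \<rho> (Max (tdeg ` F)) f"
        unfolding pnorm_def using mon_nonneg[OF \<rho>0]
        by (intro order_trans[OF sum_mono sum_mono2]) auto
      then show "sum (\<lambda>Q. norm (?t Q)) F \<le> M" using M order_trans by blast
    qed
  qed simp
  then show "?t summable_on ?A"
    by (rule abs_summable_summable)
qed

section \<open>Small divisors\<close>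

text \<open>
  All nonzero $\<lambda>_i$ are rational multiples of one of them, and finitely many rationals have a common
  denominator.
\<close>

lemma commensurable_lattice:
  fixes lam :: "nat \<Rightarrow> complex"
  assumes l: "\<forall>i\<in>{1..l}. \<forall>j\<in>{1..l}. i \<noteq> j \<longrightarrow> commensurable (lam i) (lam j)"
  obtains \<kappa> :: complex where "\<kappa> \<noteq> 0" "\<forall>i\<in>{1..l}. \<exists>z::int. lam i = of_int z * \<kappa>"
proof (cases "\<forall>i\<in>{1..l}. lam i = 0")
  case True
  then show ?thesis by (intro that[of 1]) (auto intro: exI[of _ 0])
next
  case False
  then obtain j where j: "j \<in> {1..l}" "lam j \<noteq> 0" by blast
  have "\<exists>q :: rat. lam i = of_rat q * lam j" if i: "i \<in> {1..l}" for i
  proof (cases "i = j")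
    case True
    then show ?thesis by (intro exI[of _ 1]) simp
  next
    case False
    then obtain p q :: rat where pq: "p \<noteq> 0 \<or> q \<noteq> 0" "of_rat p * lam i + of_rat q * lam j = 0"
      using l i j(1) unfolding commensurable_def by blast
    have "p \<noteq> 0" using pq j(2) by auto
    then have "lam i = of_rat (- q / p) * lam j"
    proof -
      have "of_rat p * lam i = - (of_rat q * lam j)"
        using pq(2) by (simp only: eq_neg_iff_add_eq_0)
      then have "lam i = - (of_rat q * lam j) / of_rat p"
        using \<open>p \<noteq> 0\<close> by (metis nonzero_mult_div_cancel_left of_rat_eq_0_iff)
      then show ?thesis by (simp add: of_rat_divide of_rat_minus)
    qed
    then show ?thesis ..
  qed
  then obtain q :: "nat \<Rightarrow> rat" where q: "\<And>i. i \<in> {1..l} \<Longrightarrow> lam i = of_rat (q i) * lam j"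
    by metis
  define num den where "num i = fst (quotient_of (q i))" and "den i = snd (quotient_of (q i))" for i
  have den: "den i > 0" "q i = of_int (num i) / of_int (den i)" for i
    using quotient_of_div[of "q i" "num i" "den i"] quotient_of_denom_pos'[of "q i"]
    by (simp_all add: num_def den_def)
  define N where "N = (\<Prod>i=1..l. den i)"
  have N: "N > 0" unfolding N_def using den by (intro prod_pos) auto
  show ?thesis
  proof (rule that)
    show "lam j / of_int N \<noteq> 0" using j N by simp
    show "\<forall>i\<in>{1..l}. \<exists>z::int. lam i = of_int z * (lam j / of_int N)"
    proof
      fix i assume i: "i \<in> {1..l}"
      then obtain m where m: "N = den i * m"
        unfolding N_def using dvd_prodI[of "{1..l}" i den] by auto
      then have "m \<noteq> 0" using N by auto
      have "lam i = (of_int (num i) / of_int (den i)) * lam j"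
        using q[OF i] den(2)[of i] by (simp add: of_rat_divide)
      also have "\<dots> = of_int (num i * m) * (lam j / of_int N)"
        using den(1)[of i] \<open>m \<noteq> 0\<close> by (simp add: m field_simps)
      finally show "\<exists>z::int. lam i = of_int z * (lam j / of_int N)" ..
    qed
  qed
qed

text \<open>
  Let $v = \langle K, \<lambda> \rangle - \<lambda>_i$ and let $W$ be the left-hand side. The real part of $v$ bounds $|K''|$, and then
  the triangle inequality bounds $|\langle K', \<lambda>' \rangle|$; together $W \le A|v| + B$. In particular the values
  $|v| < 1$ come from bounded $K''$ and a bounded part of the lattice of all $\langle K', \<lambda>' \rangle$, so there are
  finitely many of them. Hence the nonzero $|v|$ have a positive lower bound, which absorbs $B$.
\<close>

lemma small_divisor_bound:
  fixes lam :: "nat \<Rightarrow> complex"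
  assumes l: "l \<le> n"
    and re0: "\<And>j. j \<in> {1..l} \<Longrightarrow> Re (lam j) = 0" and pos: "\<And>j. j \<in> {l+1..n} \<Longrightarrow> Re (lam j) > 0"
    and comm: "\<forall>i\<in>{1..l}. \<forall>j\<in>{1..l}. i \<noteq> j \<longrightarrow> commensurable (lam i) (lam j)"
  obtains C where "0 < C"
    "\<And>i K. i \<in> {1..n} \<Longrightarrow> wt n lam K \<noteq> lam i \<Longrightarrow>
      1 + (\<Sum>j=l+1..n. real (Poly_Mapping.lookup K j)) + cmod (wt l lam K) \<le> C * cmod (wt n lam K - lam i)"
proof -
  obtain \<kappa> where \<kappa>: "\<kappa> \<noteq> 0" "\<forall>i\<in>{1..l}. \<exists>z::int. lam i = of_int z * \<kappa>"
    using commensurable_lattice[OF comm] .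
  define \<mu> where "\<mu> = Min (insert 1 ((\<lambda>j. Re (lam j)) ` {l+1..n}))"
  have \<mu>: "0 < \<mu>" "\<And>j. j \<in> {l+1..n} \<Longrightarrow> \<mu> \<le> Re (lam j)"
    unfolding \<mu>_def using pos by (simp, intro Min_le) auto
  define \<Lambda> where "\<Lambda> = (\<Sum>j=1..n. cmod (lam j))"
  have \<Lambda>: "0 \<le> \<Lambda>" "\<And>j. j \<in> {1..n} \<Longrightarrow> cmod (lam j) \<le> \<Lambda>"
    unfolding \<Lambda>_def by (auto intro: sum_nonneg member_le_sum)
  define s where "s K = (\<Sum>j=l+1..n. Poly_Mapping.lookup K j)" for K :: "nat \<Rightarrow>\<^sub>0 nat"
  define W where "W K = 1 + real (s K) + cmod (wt l lam K)" for K
  define t where "t K = (\<Sum>j=l+1..n. of_nat (Poly_Mapping.lookup K j) * lam j)" for K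
  have wt_split: "wt n lam K = wt l lam K + t K" for K
  proof -
    have "{1..n} = {1..l} \<union> {l+1..n}" using l by auto
    then show ?thesis unfolding wt_def t_def by (simp add: sum.union_disjoint)
  qed
  have re_wt: "Re (wt l lam K) = 0" for K
    unfolding wt_def using re0 by (simp add: sum.neutral)
  have re_t: "\<mu> * real (s K) \<le> Re (t K)" for K
    unfolding t_def s_def of_nat_sum sum_distrib_left Re_sum
    using \<mu>(2) by (intro sum_mono) (auto simp: mult.commute[of \<mu>] intro!: mult_left_mono)
  have norm_t: "cmod (t K) \<le> \<Lambda> * real (s K)" for K
    unfolding t_def s_def of_nat_sum sum_distrib_left
    using \<Lambda>(2) by (intro sum_norm_le) (auto simp: norm_mult mult.commute[of \<Lambda>] intro!: mult_left_mono)
  have s_le: "real (s K) \<le> (cmod (wt n lam K - lam i) + \<Lambda>) / \<mu>" if i: "i \<in> {1..n}" for i K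
  proof -
    have "\<mu> * real (s K) \<le> Re (wt n lam K)"
      using re_t[of K] by (simp add: wt_split re_wt)
    also have "\<dots> = Re (wt n lam K - lam i) + Re (lam i)" by simp
    also have "\<dots> \<le> cmod (wt n lam K - lam i) + \<Lambda>"
      by (intro add_mono complex_Re_le_cmod order_trans[OF complex_Re_le_cmod \<Lambda>(2)[OF i]])
    finally show ?thesis using \<mu>(1) by (simp add: field_simps)
  qed
  have norm_wt: "cmod (wt l lam K) \<le> cmod (wt n lam K - lam i) + \<Lambda> + \<Lambda> * real (s K)"
    if i: "i \<in> {1..n}" for i K
  proof -
    have "wt l lam K = (wt n lam K - lam i) + lam i - t K" by (simp add: wt_split)
    also have "cmod \<dots> \<le> cmod (wt n lam K - lam i) + cmod (lam i) + cmod (t K)"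
      using norm_triangle_ineq4[of "wt n lam K - lam i + lam i" "t K"]
        norm_triangle_ineq[of "wt n lam K - lam i" "lam i"] by linarith
    also have "\<dots> \<le> cmod (wt n lam K - lam i) + \<Lambda> + \<Lambda> * real (s K)"
      using \<Lambda>(2)[OF i] norm_t[of K] by simp
    finally show ?thesis .
  qed
  define A where "A = 1 + (1 + \<Lambda>) / \<mu>"
  define B where "B = 1 + \<Lambda> + (1 + \<Lambda>) * (\<Lambda> / \<mu>)"
  have AB: "0 < A" "0 < B" using \<Lambda>(1) \<mu>(1) by (auto simp: A_def B_def intro!: add_pos_nonneg)
  have W_le: "W K \<le> A * cmod (wt n lam K - lam i) + B" if i: "i \<in> {1..n}" for i K
  proof -
    have "W K \<le> 1 + cmod (wt n lam K - lam i) + \<Lambda> + (1 + \<Lambda>) * real (s K)"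
      using norm_wt[OF i, of K] by (simp add: W_def algebra_simps)
    also have "(1 + \<Lambda>) * real (s K) \<le> (1 + \<Lambda>) * ((cmod (wt n lam K - lam i) + \<Lambda>) / \<mu>)"
      using s_le[OF i] \<Lambda>(1) by (intro mult_left_mono) auto
    also have "1 + cmod (wt n lam K - lam i) + \<Lambda> + (1 + \<Lambda>) * ((cmod (wt n lam K - lam i) + \<Lambda>) / \<mu>) =
        A * cmod (wt n lam K - lam i) + B"
      by (simp add: A_def B_def add_divide_distrib algebra_simps)
    finally show ?thesis by simp
  qed

  \<comment> \<open>The finitely many divisors in the unit disc.\<close>
  define V where "V = {v. \<exists>i K. i \<in> {1..n} \<and> v = wt n lam K - lam i \<and> cmod v < 1}"
  have "finite V"
  proof (rule finite_subset)
    define Z :: "int set" where "Z = {- \<lceil>(A + B) / cmod \<kappa>\<rceil> .. \<lceil>(A + B) / cmod \<kappa>\<rceil>}"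
    define S where "S = {f :: nat \<Rightarrow> nat. \<forall>j. (j \<in> {l+1..n} \<longrightarrow> f j \<in> {..nat \<lceil>A + B\<rceil>}) \<and> (j \<notin> {l+1..n} \<longrightarrow> f j = 0)}"
    show "finite ((\<lambda>(z, f, i). of_int z * \<kappa> + (\<Sum>j=l+1..n. of_nat (f j) * lam j) - lam i) ` (Z \<times> S \<times> {1..n}))"
    proof (intro finite_imageI finite_cartesian_product)
      show "finite S" unfolding S_def by (rule finite_set_of_finite_funs) auto
    qed (auto simp: Z_def)
    show "V \<subseteq> (\<lambda>(z, f, i). of_int z * \<kappa> + (\<Sum>j=l+1..n. of_nat (f j) * lam j) - lam i) ` (Z \<times> S \<times> {1..n})"
    proof
      fix v assume "v \<in> V"
      then obtain i K where i: "i \<in> {1..n}" and v: "v = wt n lam K - lam i" and "cmod v < 1"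
        unfolding V_def by blast
      then have "W K \<le> A * 1 + B"
        using AB by (intro order_trans[OF W_le[OF i]] add_mono mult_left_mono) auto
      then have "cmod (wt l lam K) + real (s K) \<le> A + B" by (simp add: W_def)
      then have W: "cmod (wt l lam K) \<le> A + B" "real (s K) \<le> A + B"
        using norm_ge_zero[of "wt l lam K"] of_nat_0_le_iff[of "s K", where ?'a = real] by linarith+
      obtain \<zeta> :: "nat \<Rightarrow> int" where \<zeta>: "\<And>i. i \<in> {1..l} \<Longrightarrow> lam i = of_int (\<zeta> i) * \<kappa>"
        using \<kappa>(2) by metis
      define z where "z = (\<Sum>j=1..l. int (Poly_Mapping.lookup K j) * \<zeta> j)"
      have z: "wt l lam K = of_int z * \<kappa>"
        unfolding wt_def z_def of_int_sum sum_distrib_right using \<zeta> by (intro sum.cong) auto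
      then have "real_of_int \<bar>z\<bar> * cmod \<kappa> \<le> A + B" using W(1) by (simp add: norm_mult)
      then have "real_of_int \<bar>z\<bar> \<le> (A + B) / cmod \<kappa>" using \<kappa>(1) by (simp add: field_simps)
      then have "\<bar>z\<bar> \<le> \<lceil>(A + B) / cmod \<kappa>\<rceil>" by linarith
      then have "z \<in> Z" by (auto simp: Z_def)
      define f where "f j = (if j \<in> {l+1..n} then Poly_Mapping.lookup K j else 0)" for j
      have "Poly_Mapping.lookup K j \<le> s K" if "j \<in> {l+1..n}" for j
        unfolding s_def using that by (intro member_le_sum) auto
      then have "real (Poly_Mapping.lookup K j) \<le> real (nat \<lceil>A + B\<rceil>)" if "j \<in> {l+1..n}" for j
        using that by (intro order_trans[OF _ order_trans[OF W(2) real_nat_ceiling_ge]]) simp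
      then have "Poly_Mapping.lookup K j \<le> nat \<lceil>A + B\<rceil>" if "j \<in> {l+1..n}" for j
        using that by simp
      then have "f \<in> S" by (auto simp: S_def f_def)
      moreover have "v = of_int z * \<kappa> + (\<Sum>j=l+1..n. of_nat (f j) * lam j) - lam i"
        unfolding v wt_split z t_def f_def by simp
      ultimately show "v \<in> (\<lambda>(z, f, i). of_int z * \<kappa> + (\<Sum>j=l+1..n. of_nat (f j) * lam j) - lam i) ` (Z \<times> S \<times> {1..n})"
        using \<open>z \<in> Z\<close> i by (intro image_eqI[of _ _ "(z, f, i)"]) auto
    qed
  qed
  define \<epsilon> where "\<epsilon> = Min (insert 1 (cmod ` (V - {0})))"
  have \<epsilon>: "0 < \<epsilon>" unfolding \<epsilon>_def using \<open>finite V\<close> by auto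
  have \<epsilon>_le: "\<epsilon> \<le> cmod (wt n lam K - lam i)" if "i \<in> {1..n}" "wt n lam K \<noteq> lam i" for i K
  proof (cases "cmod (wt n lam K - lam i) < 1")
    case True
    then have "wt n lam K - lam i \<in> V - {0}" using that by (auto simp: V_def)
    then show ?thesis unfolding \<epsilon>_def using \<open>finite V\<close> by (intro Min_le) auto
  next
    case False
    have "\<epsilon> \<le> 1" unfolding \<epsilon>_def using \<open>finite V\<close> by (intro Min_le) auto
    then show ?thesis using False by simp
  qed
  show ?thesis
  proof (rule that)
    show "0 < A + B / \<epsilon>" using AB \<epsilon> by (intro add_pos_pos) auto
    fix i K assume i: "i \<in> {1..n}" and ne: "wt n lam K \<noteq> lam i"
    have "B \<le> B / \<epsilon> * cmod (wt n lam K - lam i)"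
      using \<epsilon>_le[OF i ne] \<epsilon> AB by (simp add: field_simps)
    then have "W K \<le> (A + B / \<epsilon>) * cmod (wt n lam K - lam i)"
      using W_le[OF i, of K] by (simp add: distrib_right)
    then show "1 + (\<Sum>j=l+1..n. real (Poly_Mapping.lookup K j)) + cmod (wt l lam K)
        \<le> (A + B / \<epsilon>) * cmod (wt n lam K - lam i)"
      by (simp add: W_def s_def)
  qed
qed

section \<open>The distinguished transformation converges\<close>

text \<open>
  The components of $DH \cdot G = F \circ H$ for a distinguished $H$, where \<open>sg\<close> is the subdiagonal of the linear
  part of $F$. The series $1 + b$ is the factor $a$ of the center components of the normal form.
\<close>

locale distinguished_transformation =
  fixes n l :: nat and lam sg :: "nat \<Rightarrow> complex" and X H G :: "nat \<Rightarrow> complex mfps" and b :: "complex mfps"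
  assumes l_le: "l \<le> n"
    and sg_res: "\<And>i. i \<in> {1..n} \<Longrightarrow> sg i \<noteq> 0 \<Longrightarrow> 2 \<le> i \<and> lam (i - 1) = lam i"
    and X_order: "\<And>i. i \<in> {1..n} \<Longrightarrow> order_ge 2 (X i)"
    and H_trans: "transformation n H"
    and H_dist: "\<And>i. i \<in> {1..n} \<Longrightarrow> weight_part n lam (lam i) (H i - mvar i) = 0"
    and G_hom: "\<And>i. i \<in> {1..n} \<Longrightarrow> homog n lam (lam i) (G i)"
    and conj: "\<And>i. i \<in> {1..n} \<Longrightarrow> (\<Sum>j=1..n. mderiv j (H i) * G j) =
        mconst (lam i) * H i + mconst (sg i) * H (i - 1) + msubst n (X i) H"
    and b_order: "order_ge 1 b"
    and G_center: "\<And>i. i \<in> {1..l} \<Longrightarrow> G i = mconst (lam i) * (mvar i * (1 + b))"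
begin

definition h :: "nat \<Rightarrow> complex mfps" where "h i = H i - mvar i"

text \<open>
  The unknown of the majorant argument: $p_i$ arises from $h_i$ by multiplying each coefficient with its
  divisor.
\<close>

definition p :: "nat \<Rightarrow> complex mfps" where
  "p i = (\<Sum>j=1..n. mconst (lam j) * (mvar j * mderiv j (h i))) - mconst (lam i) * h i"

definition r :: "nat \<Rightarrow> complex mfps" where "r i = weight_part n lam (lam i) (msubst n (X i) H)"

text \<open>
  Derivatives with respect to the center variables enter only through this combination, which acts
  on monomials as multiplication by $\langle P', \<lambda>' \rangle$.
\<close>

definition E :: "nat \<Rightarrow> complex mfps" where
  "E i = (\<Sum>j=1..l. mconst (lam j) * (mvar j * mderiv j (h i)))"

lemma mcoeff_p: "mcoeff (p i) K = (wt n lam K - lam i) * mcoeff (h i) K"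
  unfolding p_def by (simp only: mcoeff_arith mcoeff_euler mcoeff_mconst_mult left_diff_distrib)

lemma mcoeff_E: "mcoeff (E i) K = wt l lam K * mcoeff (h i) K"
  unfolding E_def by (rule mcoeff_euler)

lemma h_order: "i \<in> {1..n} \<Longrightarrow> order_ge 2 (h i)"
  using H_trans by (simp add: transformation_def h_def)

lemma H_order: "\<forall>i\<in>{1..n}. order_ge 1 (H i)"
proof
  fix i assume "i \<in> {1..n}"
  then have "order_ge 1 (h i + mvar i)"
    using order_ge_mono[OF h_order, of i 1] by (intro order_ge_add) auto
  then show "order_ge 1 (H i)" by (simp add: h_def)
qed

lemma h_dist: "i \<in> {1..n} \<Longrightarrow> weight_part n lam (lam i) (h i) = 0"
  using H_dist by (simp add: h_def)

lemma r_order: "i \<in> {1..n} \<Longrightarrow> order_ge 2 (r i)"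
  unfolding r_def by (intro order_ge_weight_part order_ge_msubst X_order)

lemma h_nonresonant:
  assumes "i \<in> {1..n}" "mcoeff (h i) K \<noteq> 0"
  shows "wt n lam K \<noteq> lam i"
  using arg_cong[OF h_dist[OF assms(1)], of "\<lambda>f. mcoeff f K"] assms(2) by auto

definition g :: "nat \<Rightarrow> complex mfps" where "g i = G i - mconst (lam i) * mvar i"

lemma g_hom: "j \<in> {1..n} \<Longrightarrow> homog n lam (lam j) (g j)"
proof -
  assume j: "j \<in> {1..n}"
  have "homog n lam (0 + lam j) (mconst (lam j) * mvar j)"
    using j by (intro homog_mult homog_mvar) (simp add: homog_def mcoeff_mconst)
  then show ?thesis unfolding g_def using j by (intro homog_diff G_hom) simp_all
qed

lemma homological_equation:
  assumes i: "i \<in> {1..n}"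
  shows "g i + p i + (\<Sum>j=1..n. mderiv j (h i) * g j) =
      mconst (sg i) * mvar (i - 1) + mconst (sg i) * h (i - 1) + msubst n (X i) H"
proof -
  have "(\<Sum>j=1..n. mderiv j (H i) * G j) = (\<Sum>j=1..n. (if i = j then G j else 0)) + (\<Sum>j=1..n. mderiv j (h i) * G j)"
    unfolding sum.distrib[symmetric] by (intro sum.cong) (auto simp: h_def left_diff_distrib)
  also have "(\<Sum>j=1..n. (if i = j then G j else 0)) = g i + mconst (lam i) * mvar i"
    using i by (simp add: sum.delta' g_def)
  also have "(\<Sum>j=1..n. mderiv j (h i) * G j) =
      (p i + mconst (lam i) * h i) + (\<Sum>j=1..n. mderiv j (h i) * g j)"
    unfolding p_def g_def by (simp add: right_diff_distrib sum_subtractf mult_ac)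
  finally have "g i + mconst (lam i) * mvar i + (p i + mconst (lam i) * h i + (\<Sum>j=1..n. mderiv j (h i) * g j)) =
      mconst (lam i) * H i + mconst (sg i) * H (i - 1) + msubst n (X i) H"
    using conj[OF i] by simp
  then show ?thesis
    by (simp add: h_def algebra_simps)
qed

text \<open>
  The resonant part of the homological equation: $p_i$ and $\sum_j \partial_j h_i\, g_j$ have none, since
  $g_j$ has weight $\<lambda>_j$ and $h_i$ has no part of weight $\<lambda>_i$.
\<close>

lemma g_eq:
  assumes i: "i \<in> {1..n}"
  shows "g i = mconst (sg i) * mvar (i - 1) + r i"
proof -
  let ?w = "weight_part n lam (lam i)"
  have "?w (p i) = 0"
    by (rule mfps_eqI) (simp add: mcoeff_p)
  moreover have "?w (\<Sum>j=1..n. mderiv j (h i) * g j) = 0"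
  proof -
    have "?w (mderiv j (h i) * g j) = 0" if j: "j \<in> {1..n}" for j
      using weight_part_mult_homog[OF g_hom[OF j], of "lam i - lam j" "mderiv j (h i)"]
        weight_part_mderiv[OF j, of lam "lam i" "h i"] h_dist[OF i] by simp
    then show ?thesis by (simp add: weight_part_sum)
  qed
  moreover have "?w (mconst (sg i) * mvar (i - 1)) = mconst (sg i) * mvar (i - 1) \<and> ?w (mconst (sg i) * h (i - 1)) = 0"
  proof (cases "sg i = 0")
    case True
    then show ?thesis by (auto intro!: mfps_eqI)
  next
    case False
    then have *: "2 \<le> i" "lam (i - 1) = lam i" using sg_res[OF i] by auto
    then have i': "i - 1 \<in> {1..n}" using i by auto
    then have "?w (mvar (i - 1)) = mvar (i - 1)" "?w (h (i - 1)) = 0"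
      using weight_part_homog[OF homog_mvar[OF i', of lam]] h_dist[OF i'] * by simp_all
    then show ?thesis by (simp add: weight_part_arith)
  qed
  ultimately show ?thesis
    using arg_cong[OF homological_equation[OF i], of ?w] weight_part_homog[OF g_hom[OF i]]
    by (simp add: weight_part_arith r_def)
qed

lemma p_eq:
  assumes i: "i \<in> {1..n}"
  shows "p i = mconst (sg i) * h (i - 1) + (msubst n (X i) H - r i) - b * E i
        - (\<Sum>j=l+1..n. mderiv j (h i) * (mconst (sg j) * mvar (j - 1) + r j))"
proof -
  have "{1..n} = {1..l} \<union> {l+1..n}" using l_le by auto
  then have "(\<Sum>j=1..n. mderiv j (h i) * g j) =
      (\<Sum>j=1..l. mderiv j (h i) * g j) + (\<Sum>j=l+1..n. mderiv j (h i) * g j)"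
    by (simp add: sum.union_disjoint)
  also have "(\<Sum>j=1..l. mderiv j (h i) * g j) = b * E i"
    unfolding E_def sum_distrib_left by (intro sum.cong) (simp_all add: g_def G_center algebra_simps)
  also have "(\<Sum>j=l+1..n. mderiv j (h i) * g j) =
      (\<Sum>j=l+1..n. mderiv j (h i) * (mconst (sg j) * mvar (j - 1) + r j))"
    by (intro sum.cong) (simp_all add: g_eq)
  finally show ?thesis
    using homological_equation[OF i] g_eq[OF i] by (simp add: algebra_simps)
qed

text \<open>
  For $\<lambda>_i \ne 0$ this recovers $b$ from $X \circ H$.
\<close>

lemma b_eq:
  assumes i: "i \<in> {1..l}" and K: "2 \<le> tdeg K"
  shows "lam i * mcoeff (mvar i * b) K = mcoeff (r i) K"
proof -
  have i': "i \<in> {1..n}" using i l_le by simp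
  have "K \<noteq> Poly_Mapping.single (i - 1) 1" using K by auto
  then have "mcoeff (g i) K = mcoeff (r i) K"
    by (simp add: g_eq[OF i'] mcoeff_mvar)
  moreover have "g i = mconst (lam i) * (mvar i * b)"
    by (simp add: g_def G_center[OF i] algebra_simps)
  ultimately show ?thesis by simp
qed

end

context distinguished_transformation
begin

context
  fixes C :: real
  assumes C_pos: "0 < C"
    and divisor: "\<And>i K. i \<in> {1..n} \<Longrightarrow> wt n lam K \<noteq> lam i \<Longrightarrow>
      1 + (\<Sum>j=l+1..n. real (Poly_Mapping.lookup K j)) + cmod (wt l lam K) \<le> C * cmod (wt n lam K - lam i)"
begin

lemma coefficient_bound:
  assumes i: "i \<in> {1..n}" and T: "T \<le> 1 + (\<Sum>j=l+1..n. real (Poly_Mapping.lookup K j)) + cmod (wt l lam K)"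
  shows "T * cmod (mcoeff (h i) K) \<le> C * cmod (mcoeff (p i) K)"
proof (cases "mcoeff (h i) K = 0")
  case False
  have "T * cmod (mcoeff (h i) K) \<le> (C * cmod (wt n lam K - lam i)) * cmod (mcoeff (h i) K)"
    using T divisor[OF i h_nonresonant[OF i False]] by (intro mult_right_mono) auto
  then show ?thesis by (simp add: mcoeff_p norm_mult)
qed (simp add: mcoeff_p)

lemma h_bound: "i \<in> {1..n} \<Longrightarrow> cmod (mcoeff (h i) K) \<le> C * cmod (mcoeff (p i) K)"
  using coefficient_bound[of i 1 K] by (simp add: sum_nonneg add_nonneg_nonneg)

lemma E_bound: "i \<in> {1..n} \<Longrightarrow> cmod (mcoeff (E i) K) \<le> C * cmod (mcoeff (p i) K)"
  using coefficient_bound[of i "cmod (wt l lam K)" K]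
  by (simp add: mcoeff_E norm_mult sum_nonneg add_nonneg_nonneg)

lemma derivative_bound:
  assumes i: "i \<in> {1..n}" and j: "j \<in> {l+1..n}"
  shows "cmod (mcoeff (mvar j * mderiv j (h i)) K) \<le> C * cmod (mcoeff (p i) K)"
proof -
  have "real (Poly_Mapping.lookup K j) \<le> (\<Sum>j=l+1..n. real (Poly_Mapping.lookup K j))"
    using j by (intro member_le_sum) auto
  then have "real (Poly_Mapping.lookup K j) \<le>
      1 + (\<Sum>j=l+1..n. real (Poly_Mapping.lookup K j)) + cmod (wt l lam K)"
    using norm_ge_zero[of "wt l lam K"] by linarith
  from coefficient_bound[OF i this] show ?thesis
    by (simp add: mcoeff_mvar_mult_mderiv norm_mult)
qed

text \<open>
  Each term on the right of \<open>p_eq\<close> is estimated by the weighted norm $V$ of $p$, times a factor that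
  is small if $B$ is large and $t$ is small, apart from $X_i \circ H$, whose share is at most $t$. The
  number $\<kappa>$ stands for the constant in the bound of $b$ by $X \circ H$; if $\<lambda>' = 0$, then all $E_i$ vanish
  and $b$ does not occur.
\<close>

lemma majorant_step:
  fixes \<rho> :: "nat \<Rightarrow> real" and D :: nat and s B S t \<kappa> :: real
  defines "u \<equiv> \<lambda>i. pnorm n \<rho> (Suc D) (p i)"
  defines "V \<equiv> \<Sum>i=1..n. u i / \<rho> i"
  assumes s: "0 < s" "\<And>i. i \<in> {1..n} \<Longrightarrow> s \<le> \<rho> i"
    and B: "0 < B" "\<And>i. i \<in> {2..n} \<Longrightarrow> \<rho> (i - 1) = \<rho> i / B"
    and S: "0 \<le> S" "\<And>i. i \<in> {1..n} \<Longrightarrow> cmod (sg i) \<le> S"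
    and t: "0 \<le> t" "\<And>i. i \<in> {1..n} \<Longrightarrow> pnorm n \<rho> (Suc D) (msubst n (X i) H) \<le> s * t"
    and \<kappa>: "0 \<le> \<kappa>" "(\<exists>i\<in>{1..l}. lam i \<noteq> 0 \<and> \<kappa> = 1 / cmod (lam i)) \<or> (\<forall>i\<in>{1..l}. lam i = 0)"
    and i: "i \<in> {1..n}"
  shows "u i / \<rho> i \<le> (S * C / B + \<kappa> * C * t + n * (C * (S / B + t))) * V + t"
proof -
  have \<rho>_pos: "0 < \<rho> j" if "j \<in> {1..n}" for j
    using s(1) s(2)[OF that] by linarith
  interpret polyradius n \<rho>
    by standard (use \<rho>_pos in \<open>auto intro: less_imp_le\<close>)
  let ?N = "pnorm n \<rho> (Suc D)"
  have u0: "0 \<le> u j" for j by (simp add: u_def pnorm_nonneg)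
  have "u j / \<rho> j \<le> V" if "j \<in> {1..n}" for j
    unfolding V_def using that u0 \<rho>_pos by (intro member_le_sum) (auto intro: divide_nonneg_pos)
  then have u_le: "u j \<le> \<rho> j * V" if "j \<in> {1..n}" for j
    using \<rho>_pos[OF that] by (metis that pos_divide_le_eq mult.commute)
  have V0: "0 \<le> V"
    unfolding V_def using u0 \<rho>_pos by (intro sum_nonneg) (auto intro: divide_nonneg_pos)
  have r_le: "?N (r j) \<le> s * t" if "j \<in> {1..n}" for j
  proof -
    have "?N (r j) \<le> 1 * ?N (msubst n (X j) H)"
      by (rule pnorm_le) (simp add: r_def)
    then show ?thesis using t(2)[OF that] by simp
  qed

  have T1: "?N (mconst (sg i) * h (i - 1)) \<le> \<rho> i * (S * C / B * V)"
  proof (cases "sg i = 0")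
    case True
    then show ?thesis
      using V0 S B C_pos \<rho>_pos[OF i] by (simp add: pnorm_mconst_mult)
  next
    case False
    then have i': "i \<in> {2..n}" "i - 1 \<in> {1..n}" using sg_res[OF i] i by auto
    have "?N (mconst (sg i) * h (i - 1)) = cmod (sg i) * ?N (h (i - 1))"
      by (rule pnorm_mconst_mult)
    also have "\<dots> \<le> S * (C * u (i - 1))"
      unfolding u_def using S i h_bound[OF i'(2)]
      by (intro mult_mono pnorm_le) (auto simp: pnorm_nonneg)
    also have "\<dots> \<le> S * (C * (\<rho> (i - 1) * V))"
      using S C_pos u_le[OF i'(2)] by (intro mult_left_mono) auto
    finally show ?thesis by (simp add: B(2)[OF i'(1)] mult_ac)
  qed

  have T2: "?N (msubst n (X i) H - r i) \<le> \<rho> i * t"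
  proof -
    have "?N (msubst n (X i) H - r i) \<le> 1 * ?N (msubst n (X i) H)"
      by (rule pnorm_le) (simp add: r_def)
    also have "\<dots> \<le> s * t" using t(2)[OF i] by simp
    also have "\<dots> \<le> \<rho> i * t" using s(2)[OF i] t(1) by (rule mult_right_mono)
    finally show ?thesis .
  qed

  have T3: "?N (b * E i) \<le> \<rho> i * (\<kappa> * C * t * V)"
    using \<kappa>(2)
  proof
    assume "\<forall>i\<in>{1..l}. lam i = 0"
    then have "wt l lam K = 0" for K by (simp add: wt_def)
    then have "E i = 0" by (intro mfps_eqI) (simp add: mcoeff_E)
    then show ?thesis
      using V0 \<kappa>(1) t(1) C_pos \<rho>_pos[OF i] by simp
  next
    assume "\<exists>i\<in>{1..l}. lam i \<noteq> 0 \<and> \<kappa> = 1 / cmod (lam i)"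
    then obtain k where k: "k \<in> {1..l}" "lam k \<noteq> 0" "\<kappa> = 1 / cmod (lam k)" by blast
    then have k': "k \<in> {1..n}" using l_le by simp
    have "s * pnorm n \<rho> D b \<le> \<rho> k * pnorm n \<rho> D b"
      using s(2)[OF k'] pnorm_nonneg by (rule mult_right_mono)
    also have "\<dots> \<le> ?N (mvar k * b)" by (rule pnorm_mvar_mult_ge[OF k'])
    also have "\<dots> \<le> \<kappa> * ?N (r k)"
    proof (rule pnorm_le)
      fix K
      show "cmod (mcoeff (mvar k * b) K) \<le> \<kappa> * cmod (mcoeff (r k) K)"
      proof (cases "2 \<le> tdeg K")
        case True
        then show ?thesis
          using b_eq[OF k(1) True, symmetric] k by (simp add: norm_mult)
      next
        case False
        moreover have "order_ge (1 + 1) (mvar k * b)"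
          by (intro order_ge_mult b_order) simp
        ultimately show ?thesis using \<kappa>(1) by (simp add: order_ge_def)
      qed
    qed
    also have "\<dots> \<le> \<kappa> * (s * t)" using r_le[OF k'] \<kappa>(1) by (rule mult_left_mono)
    finally have b_le: "pnorm n \<rho> D b \<le> \<kappa> * t" using s(1) by (simp add: mult.left_commute)
    have "order_ge 1 (E i)"
      using order_ge_mono[OF h_order[OF i], of 1] by (auto simp: order_ge_def mcoeff_E)
    then have "?N (b * E i) \<le> pnorm n \<rho> D b * ?N (E i)"
      using pnorm_mult[of 0 b 1 "E i" "Suc D"] by (simp add: One_nat_def)
    also have "\<dots> \<le> (\<kappa> * t) * (C * (\<rho> i * V))"
    proof (rule mult_mono[OF b_le])
      have "?N (E i) \<le> C * u i"
        unfolding u_def using E_bound[OF i] by (intro pnorm_le)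
      also have "\<dots> \<le> C * (\<rho> i * V)" using u_le[OF i] C_pos by simp
      finally show "?N (E i) \<le> C * (\<rho> i * V)" .
    qed (use \<kappa>(1) t(1) pnorm_nonneg in auto)
    finally show ?thesis by (simp add: mult_ac)
  qed

  have T4: "?N (mderiv j (h i) * (mconst (sg j) * mvar (j - 1) + r j)) \<le> \<rho> i * (C * (S / B + t) * V)"
    if j: "j \<in> {l+1..n}" for j
  proof -
    have j': "j \<in> {1..n}" using j by simp
    have "\<rho> j * pnorm n \<rho> D (mderiv j (h i)) \<le> ?N (mvar j * mderiv j (h i))"
      by (rule pnorm_mvar_mult_ge[OF j'])
    also have "\<dots> \<le> C * u i"
      unfolding u_def using derivative_bound[OF i j] by (intro pnorm_le)
    also have "\<dots> \<le> C * (\<rho> i * V)" using u_le[OF i] C_pos by simp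
    finally have d: "pnorm n \<rho> D (mderiv j (h i)) \<le> C * (\<rho> i * V) / \<rho> j"
      using \<rho>_pos[OF j'] by (simp add: field_simps)
    have "?N (mconst (sg j) * mvar (j - 1)) \<le> \<rho> j * (S / B)"
    proof (cases "sg j = 0")
      case True
      then show ?thesis using S B \<rho>_pos[OF j'] by (simp add: pnorm_mconst_mult)
    next
      case False
      then have jj: "j \<in> {2..n}" "j - 1 \<in> {1..n}" using sg_res[OF j'] j' by auto
      have "?N (mconst (sg j) * mvar (j - 1)) \<le> S * \<rho> (j - 1)"
        unfolding pnorm_mconst_mult using S j' pnorm_mvar_le[OF jj(2)] by (intro mult_mono) (auto simp: pnorm_nonneg)
      then show ?thesis by (simp add: B(2)[OF jj(1)] mult_ac)
    qed
    moreover have "?N (r j) \<le> \<rho> j * t"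
      using r_le[OF j'] mult_right_mono[OF s(2)[OF j'] t(1)] by linarith
    ultimately have q: "?N (mconst (sg j) * mvar (j - 1) + r j) \<le> \<rho> j * (S / B + t)"
      using pnorm_add[of "Suc D" "mconst (sg j) * mvar (j - 1)" "r j"] by (simp add: distrib_left)
    have "order_ge 1 (mconst (sg j) * mvar (j - 1) + r j)"
      using order_ge_mono[OF r_order[OF j'], of 1] by (intro order_ge_add order_ge_mult_left) auto
    then have "?N (mderiv j (h i) * (mconst (sg j) * mvar (j - 1) + r j)) \<le>
        pnorm n \<rho> D (mderiv j (h i)) * ?N (mconst (sg j) * mvar (j - 1) + r j)"
      using pnorm_mult[of 0 "mderiv j (h i)" 1 _ "Suc D"] by (simp add: One_nat_def)
    also have "\<dots> \<le> (C * (\<rho> i * V) / \<rho> j) * (\<rho> j * (S / B + t))"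
      using d q C_pos V0 \<rho>_pos[OF i] \<rho>_pos[OF j'] by (intro mult_mono) (auto simp: pnorm_nonneg)
    also have "\<dots> = \<rho> i * (C * (S / B + t) * V)"
      using \<rho>_pos[OF j'] by simp
    finally show ?thesis .
  qed

  have "?N (\<Sum>j=l+1..n. mderiv j (h i) * (mconst (sg j) * mvar (j - 1) + r j)) \<le>
      (\<Sum>j=l+1..n. \<rho> i * (C * (S / B + t) * V))"
    using T4 by (intro order_trans[OF pnorm_sum] sum_mono) auto
  also have "\<dots> = real (n - l) * (\<rho> i * (C * (S / B + t) * V))"
    by simp
  also have "\<dots> \<le> real n * (\<rho> i * (C * (S / B + t) * V))"
    using C_pos S(1) B(1) t(1) V0 \<rho>_pos[OF i] by (intro mult_right_mono) auto
  finally have T5: "?N (\<Sum>j=l+1..n. mderiv j (h i) * (mconst (sg j) * mvar (j - 1) + r j)) \<le>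
      real n * (\<rho> i * (C * (S / B + t) * V))" .

  have "u i \<le> ?N (mconst (sg i) * h (i - 1)) + ?N (msubst n (X i) H - r i) + ?N (b * E i)
      + ?N (\<Sum>j=l+1..n. mderiv j (h i) * (mconst (sg j) * mvar (j - 1) + r j))"
    unfolding u_def
    by (subst p_eq[OF i])
       (intro order_trans[OF pnorm_diff] add_mono order_trans[OF pnorm_add] order_refl)
  also have "\<dots> \<le> \<rho> i * ((S * C / B + \<kappa> * C * t + n * (C * (S / B + t))) * V + t)"
    using T1 T2 T3 T5 by (simp add: algebra_simps)
  finally show ?thesis using \<rho>_pos[OF i] by (simp add: field_simps)
qed

text \<open>
  The weights $\<rho>_i = B^i s$ are chosen such that the factor in \<open>majorant_step\<close>, summed over $i$, is at most
  $1/2$: the parameter $B$ takes care of the nilpotent terms and $s$ of the others.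
\<close>

theorem H_convergent:
  assumes R: "0 < R" and M: "0 \<le> M" "\<And>i D. i \<in> {1..n} \<Longrightarrow> pnorm n (\<lambda>_. R) D (X i) \<le> M"
    and i: "i \<in> {1..n}"
  shows "convergent_mfps n (H i)"
proof -
  define S where "S = (\<Sum>i=1..n. cmod (sg i))"
  have S: "0 \<le> S" "cmod (sg i) \<le> S" if "i \<in> {1..n}" for i
    unfolding S_def using that by (auto intro: sum_nonneg member_le_sum)
  have S0: "0 \<le> S" unfolding S_def by (intro sum_nonneg) simp
  define B where "B = max 1 (4 * (n * (n + 1)) * S * C)"
  have B: "1 \<le> B" "4 * (n * (n + 1)) * S * C \<le> B" by (auto simp: B_def)
  have "\<exists>\<kappa>\<ge>0. (\<exists>i\<in>{1..l}. lam i \<noteq> 0 \<and> \<kappa> = 1 / cmod (lam i)) \<or> (\<forall>i\<in>{1..l}. lam i = 0)"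
  proof (cases "\<forall>i\<in>{1..l}. lam i = 0")
    case False
    then obtain i where "i \<in> {1..l}" "lam i \<noteq> 0" by blast
    then show ?thesis by (intro exI[of _ "1 / cmod (lam i)"]) auto
  qed (auto intro: exI[of _ 0])
  then obtain \<kappa> where \<kappa>: "0 \<le> \<kappa>" "(\<exists>i\<in>{1..l}. lam i \<noteq> 0 \<and> \<kappa> = 1 / cmod (lam i)) \<or> (\<forall>i\<in>{1..l}. lam i = 0)"
    by blast
  \<comment> \<open>If $V_D \<le> 1$, the truncated norms of the $H_i$ are at most $s q R$, and those of the $X_i \<circ> H$ one degree higher at most $s^2$ times \<open>M1\<close>.\<close>
  define q where "q = B ^ n * (1 + C) / R"
  define M1 where "M1 = q\<^sup>2 * M"
  \<comment> \<open>The factor $s = 1/d$ makes each of these summands at most $1$.\<close>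
  define d where "d = 1 + q + 4 * n * C * (\<kappa> + n) * M1 + 2 * n * M1"
  define s where "s = 1 / d"
  have q: "0 \<le> q" unfolding q_def using B C_pos R by (intro divide_nonneg_pos mult_nonneg_nonneg) auto
  have M1: "0 \<le> M1" unfolding M1_def using M by simp
  have pieces: "0 \<le> 4 * n * C * (\<kappa> + n) * M1" "0 \<le> 2 * n * M1"
    using C_pos \<kappa>(1) M1 by simp_all
  then have d: "1 \<le> d" using q unfolding d_def by linarith
  then have s: "0 < s" by (simp add: s_def)
  have sq: "s * q \<le> 1" and sM: "4 * n * C * (\<kappa> + n) * M1 * s \<le> 1" "2 * n * M1 * s \<le> 1"
    using d q pieces by (simp_all add: s_def d_def field_simps)

  define \<rho> where "\<rho> i = B ^ i * s" for i
  have \<rho>_ge: "s \<le> \<rho> i" for i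
    using B(1) s by (simp add: \<rho>_def)
  have \<rho>_pos: "0 < \<rho> i" for i using \<rho>_ge[of i] s by linarith
  have \<rho>_le: "\<rho> i \<le> B ^ n * s" if "i \<in> {1..n}" for i
    unfolding \<rho>_def using B(1) s that by (intro mult_right_mono power_increasing) auto
  have \<rho>_ratio: "\<rho> (i - 1) = \<rho> i / B" if "i \<in> {2..n}" for i
  proof -
    have "i = Suc (i - 1)" using that by simp
    then have "B ^ i = B * B ^ (i - 1)" by (metis power_Suc)
    then show ?thesis using B(1) by (simp add: \<rho>_def)
  qed
  interpret polyradius n \<rho>
    by standard (use \<rho>_pos in \<open>auto intro: less_imp_le\<close>)

  define V where "V D = (\<Sum>i=1..n. pnorm n \<rho> D (p i) / \<rho> i)" for D
  have p_le: "pnorm n \<rho> D (p i) \<le> \<rho> i * V D" if "i \<in> {1..n}" for i D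
  proof -
    have "pnorm n \<rho> D (p i) / \<rho> i \<le> V D"
      unfolding V_def using that \<rho>_pos by (intro member_le_sum) (auto intro!: divide_nonneg_pos pnorm_nonneg)
    then show ?thesis using \<rho>_pos[of i] by (simp add: field_simps)
  qed
  have H_le: "pnorm n \<rho> D (H i) \<le> (1 + C) * \<rho> i" if i: "i \<in> {1..n}" and V: "V D \<le> 1" for i D
  proof -
    have "pnorm n \<rho> D (mvar i + h i) \<le> pnorm n \<rho> D (mvar i) + pnorm n \<rho> D (h i)"
      by (rule pnorm_add)
    also have "\<dots> \<le> \<rho> i + C * pnorm n \<rho> D (p i)"
      using pnorm_mvar_le[OF i] pnorm_le[OF h_bound[OF i]] by (rule add_mono)
    also have "\<dots> \<le> \<rho> i + C * (\<rho> i * 1)"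
      using p_le[OF i, of D] V \<rho>_pos[of i] C_pos
      by (intro add_left_mono mult_left_mono order_trans[OF p_le[OF i]]) auto
    finally show ?thesis by (simp add: h_def algebra_simps)
  qed
  have V_le: "V D \<le> 1" for D
  proof (induction D)
    case 0
    have "pnorm n \<rho> 0 (p i) \<le> 0 * pnorm n \<rho> 0 (p i)" if "i \<in> {1..n}" for i
      using h_order[OF that] by (intro pnorm_le) (simp add: exps_def mcoeff_p order_ge_def)
    then have "V 0 \<le> (\<Sum>i=1..n. 0)"
      unfolding V_def using \<rho>_pos by (intro sum_mono) (simp add: divide_le_0_iff less_imp_le)
    then show ?case by simp
  next
    case (Suc D)
    have X: "pnorm n \<rho> (Suc D) (msubst n (X i) H) \<le> s * (M1 * s)" if i: "i \<in> {1..n}" for i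
    proof -
      have "pnorm n \<rho> D (H j) \<le> (s * q) * R" if j: "j \<in> {1..n}" for j
      proof -
        have "pnorm n \<rho> D (H j) \<le> (1 + C) * (B ^ n * s)"
          using H_le[OF j Suc] \<rho>_le[OF j] C_pos by (meson add_nonneg_nonneg less_imp_le mult_left_mono order_trans zero_le_one)
        then show ?thesis using R by (simp add: q_def mult_ac)
      qed
      then have "pnorm n \<rho> (Suc D) (msubst n (X i) H) \<le> (s * q)\<^sup>2 * M"
        using s q sq M(2)[OF i] R X_order[OF i] H_order by (intro pnorm_msubst_le[where R = R]) auto
      then show ?thesis by (simp add: M1_def power2_eq_square mult_ac)
    qed
    define c where "c = S * C / B + \<kappa> * C * (M1 * s) + n * (C * (S / B + M1 * s))"
    have v: "pnorm n \<rho> (Suc D) (p i) / \<rho> i \<le> c * V (Suc D) + M1 * s" if i: "i \<in> {1..n}" for i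
      unfolding c_def V_def
      by (rule majorant_step[where s = s]) (use s \<rho>_ge B \<rho>_ratio S S0 M1 X \<kappa> i in auto)
    have "V (Suc D) \<le> (\<Sum>i=1..n. c * V (Suc D) + M1 * s)"
      unfolding V_def[of "Suc D"] using v by (intro sum_mono) (simp add: V_def)
    also have "\<dots> = (n * c) * V (Suc D) + n * M1 * s"
      by (simp add: algebra_simps)
    also have "\<dots> \<le> 1 / 2 * V (Suc D) + 1 / 2"
    proof (intro add_mono mult_right_mono)
      have "n * c = n * (n + 1) * S * C / B + n * C * (\<kappa> + n) * M1 * s"
        by (simp add: c_def algebra_simps add_divide_distrib)
      moreover have "n * (n + 1) * S * C / B \<le> 1 / 4"
        using B by (simp add: field_simps)
      ultimately show "n * c \<le> 1 / 2" using sM(1) by simp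
      show "0 \<le> V (Suc D)"
        unfolding V_def using \<rho>_pos by (intro sum_nonneg) (auto intro!: divide_nonneg_pos pnorm_nonneg)
    qed (use sM(2) in simp)
    finally show ?case by simp
  qed
  show ?thesis
    using \<rho>_ge by (intro pnorm_bounded_imp_convergent[OF s _ H_le[OF i V_le]]) simp
qed

end

end


section \<open>Linear part and conclusion\<close>

lemma mconst_0 [simp]: "mconst 0 = (0 :: 'a::comm_ring_1 mfps)"
  by (rule mfps_eqI) (simp add: mcoeff_mconst)

text \<open>
  The subdiagonal entry of the first row, where $i - 1 = 0$ is no index, is read as zero.
\<close>

lemma jordan_sum:
  assumes i: "i \<in> {1..n}"
  shows "(\<Sum>j=1..n. mconst (jordan_matrix lam sig i j) * f j) =
    mconst (lam i) * f i + mconst (if 2 \<le> i then sig i else 0) * (f (i - 1) :: complex mfps)"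
proof -
  have "(\<Sum>j=1..n. mconst (jordan_matrix lam sig i j) * f j) =
      (\<Sum>j=1..n. (if j = i then mconst (lam i) * f j else 0) +
        (if j = i - 1 then mconst (if 2 \<le> i then sig i else 0) * f j else 0))"
    using i by (intro sum.cong) (auto simp: jordan_matrix_def)
  also have "\<dots> = mconst (lam i) * f i + mconst (if 2 \<le> i then sig i else 0) * f (i - 1)"
    using i by (auto simp: sum.distrib)
  finally show ?thesis .
qed

lemma mcoeff_linear_field_eq_0:
  assumes "tdeg K \<noteq> 1"
  shows "mcoeff (linear_field n A i) K = 0"
proof -
  have "K \<noteq> Poly_Mapping.single j 1" for j using assms by auto
  then show ?thesis by (simp add: linear_field_def mcoeff_mvar)
qed

theorem theorem60:
  fixes n l :: nat
    and lam sig :: "nat \<Rightarrow> complex"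
    and F X G :: "nat \<Rightarrow> complex mfps"
    and a :: "complex mfps"
  assumes analytic: "convergent_field n F"
    and F_eq: "\<forall>i\<in>{1..n}. F i = linear_field n (jordan_matrix lam sig) i + X i"
    and X_order: "\<forall>i\<in>{1..n}. order_ge 2 (X i)"
    and jordan: "\<forall>i\<in>{2..n}. lam i \<noteq> lam (i - 1) \<longrightarrow> sig i = 0"
    and l_le: "l \<le> n"
    and imaginary: "\<forall>i\<in>{1..l}. Re (lam i) = 0"
    and positive: "\<forall>i\<in>{l+1..n}. Re (lam i) > 0"
    and ordered: "\<forall>i\<in>{l+1..n}. \<forall>j\<in>{l+1..n}. i \<le> j \<longrightarrow> Re (lam i) \<le> Re (lam j)"
    and commens: "\<forall>i\<in>{1..l}. \<forall>j\<in>{1..l}. i \<noteq> j \<longrightarrow> commensurable (lam i) (lam j)"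
    and G_nf: "normal_form_of n lam F G"
    and a_vars: "in_vars {1..l} a"
    and a_const: "mcoeff a 0 = 1"
    and G_eq: "\<forall>i\<in>{1..l}. G i = mconst (lam i) * mvar i * a"
  shows "\<exists>H Ft. convergent_transformation n H \<and> transforms_to n H F Ft \<and> in_normal_form n lam Ft"
proof -
  have F_iv: "\<forall>i\<in>{1..n}. in_vars {1..n} (F i)" and F_conv: "\<forall>i\<in>{1..n}. convergent_mfps n (F i)"
    using analytic by (auto simp: convergent_field_def formal_field_def)
  obtain H0 where H0: "transformation n H0" "transforms_to n H0 F G"
    using G_nf by (auto simp: normal_form_of_def)
  have G_hom: "\<forall>i\<in>{1..n}. homog n lam (lam i) (G i)"
    using G_nf by (simp add: normal_form_of_def in_normal_form_iff)
  have a_iv: "in_vars {1..n} a"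
    using in_vars_mono[OF a_vars] l_le by auto
  have re0: "Re (lam j) = 0" if "j \<in> {1..l}" for j using imaginary that by blast
  have pos: "Re (lam j) > 0" if "j \<in> {l+1..n}" for j using positive that by blast
  obtain H Ft b where H: "transformation n H" "\<forall>i\<in>{1..n}. weight_part n lam (lam i) (H i - mvar i) = 0"
    and Ft: "transforms_to n H F Ft" "\<forall>i\<in>{1..n}. homog n lam (lam i) (Ft i)"
    and b: "order_ge 1 b" "\<forall>i\<in>{1..l}. Ft i = mconst (lam i) * (mvar i * (1 + b))"
    by (rule distinguished_normal_form[OF F_iv H0 G_hom l_le re0 pos a_iv a_const G_eq])
  define sg where "sg i = (if 2 \<le> i then sig i else 0)" for i
  interpret distinguished_transformation n l lam sg X H Ft b
  proof
    show "2 \<le> i \<and> lam (i - 1) = lam i" if "i \<in> {1..n}" "sg i \<noteq> 0" for i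
    proof -
      have "i \<in> {2..n}" "sig i \<noteq> 0" using that by (auto simp: sg_def split: if_splits)
      then have "lam i = lam (i - 1)" using jordan by blast
      then show ?thesis using \<open>i \<in> {2..n}\<close> by simp
    qed
    fix i assume i: "i \<in> {1..n}"
    have H_ord: "\<forall>i\<in>{1..n}. order_ge 1 (H i)"
    proof
      fix i assume "i \<in> {1..n}"
      then have "order_ge 1 ((H i - mvar i) + mvar i)"
        using H(1) by (intro order_ge_add) (auto simp: transformation_def intro: order_ge_mono[of 2])
      then show "order_ge 1 (H i)" by simp
    qed
    have "(\<Sum>j=1..n. mderiv j (H i) * Ft j) = msubst n (F i) H"
      using Ft(1) i by (simp add: transforms_to_def)
    also have "\<dots> = (\<Sum>j=1..n. mconst (jordan_matrix lam sig i j) * H j) + msubst n (X i) H"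
      using i F_eq by (simp add: msubst_arith linear_field_def msubst_sum msubst_mvar[OF H_ord])
    finally show "(\<Sum>j=1..n. mderiv j (H i) * Ft j) =
        mconst (lam i) * H i + mconst (sg i) * H (i - 1) + msubst n (X i) H"
      using jordan_sum[OF i] by (simp add: sg_def)
  qed (use l_le X_order H Ft b in auto)

  obtain C where C: "0 < C" "\<And>i K. i \<in> {1..n} \<Longrightarrow> wt n lam K \<noteq> lam i \<Longrightarrow>
      1 + (\<Sum>j=l+1..n. real (Poly_Mapping.lookup K j)) + cmod (wt l lam K) \<le> C * cmod (wt n lam K - lam i)"
  proof (rule small_divisor_bound[OF l_le re0 pos commens])
    fix C assume C: "0 < C" "\<And>i K. i \<in> {1..n} \<Longrightarrow> wt n lam K \<noteq> lam i \<Longrightarrow>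
      1 + (\<Sum>j=l+1..n. real (Poly_Mapping.lookup K j)) + cmod (wt l lam K) \<le> C * cmod (wt n lam K - lam i)"
    show thesis by (rule that[OF C])
  qed

  have "\<forall>i\<in>{1..n}. \<exists>R M. 0 < R \<and> (\<forall>D. pnorm n (\<lambda>_. R) D (F i) \<le> M)"
    using F_conv convergent_imp_pnorm_bounded by metis
  then obtain Rf Mf where RM: "\<And>i. i \<in> {1..n} \<Longrightarrow> 0 < Rf i"
    "\<And>i D. i \<in> {1..n} \<Longrightarrow> pnorm n (\<lambda>_. Rf i) D (F i) \<le> Mf i"
    by metis
  define R where "R = Min (insert 1 (Rf ` {1..n}))"
  define M where "M = (\<Sum>i=1..n. \<bar>Mf i\<bar>)"
  have R: "0 < R" unfolding R_def using RM(1) by auto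
  have R_le: "R \<le> Rf i" if "i \<in> {1..n}" for i
    unfolding R_def using that by (intro Min_le) auto
  have M0: "0 \<le> M" unfolding M_def by (intro sum_nonneg) simp
  have X_bound: "pnorm n (\<lambda>_. R) D (X i) \<le> M" if i: "i \<in> {1..n}" for i D
  proof -
    interpret polyradius n "\<lambda>_. R" by standard (use R in auto)
    have "pnorm n (\<lambda>_. R) D (X i) \<le> 1 * pnorm n (\<lambda>_. R) D (F i)"
    proof (rule pnorm_le)
      fix K
      show "cmod (mcoeff (X i) K) \<le> 1 * cmod (mcoeff (F i) K)"
        using X_order F_eq i by (cases "tdeg K < 2") (auto simp: order_ge_def mcoeff_linear_field_eq_0)
    qed
    also have "1 * pnorm n (\<lambda>_. R) D (F i) \<le> pnorm n (\<lambda>_. Rf i) D (F i)"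
      unfolding pnorm_def using R R_le[OF i]
      by (auto intro!: sum_mono mult_left_mono mon_mono)
    also have "\<dots> \<le> Mf i" by (rule RM(2)[OF i])
    also have "\<dots> \<le> \<bar>Mf i\<bar>" by simp
    also have "\<dots> \<le> M" unfolding M_def using i by (intro member_le_sum) auto
    finally show ?thesis .
  qed
  have "convergent_mfps n (H i)" if "i \<in> {1..n}" for i
    by (rule H_convergent[OF C R M0 X_bound that])
  then have "convergent_transformation n H"
    using H(1) by (simp add: convergent_transformation_def)
  moreover have "in_normal_form n lam Ft"
    using Ft(2) by (simp add: in_normal_form_iff)
  ultimately show ?thesis using Ft(1) by blast
qed

end
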